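(* Assume $g(x,u)\ge \eta_1(\lambda\zeta(x)u^{-2}-\gamma u)$ for all $x\in D$, $u>0$, for some constant $\eta_1>0$. Consider the random (stopping) time $$\tau^*:=\inf\left\{t>0:\ \int_0^t e^{-3(\eta_1\gamma s-\mu_1K(s)-A(s))+3N_s}\,ds\ \ge\ \frac{\langle v_0,\psi_1\rangle_D^3}{3\lambda\eta_1\zeta_m}\right\}.$$ Then, on the event $\{\tau^*<\infty\}$, the solution $v$ of the random problem (R), and thus the solution $z=e^{-N_t}v$ of the stochastic problem (S), quenches in finite time $\tau$, where $\tau\le\tau^*$ $\mathbb P$-a.s.
   Context: Setting. $D\subset\mathbb R^d$ is an open set with compact Lipschitz boundary, $D^c=\mathbb R^d\setminus D$, $\langle\cdot,\cdot\rangle_D$ is the $L^2(D)$ inner product. $\nu:\mathbb R^d\setminus\{0\}\to[0,\infty)$ is the density of a symmetric Lévy measure, and $\mathcal Lu(x)=\mathrm{p.v.}\int_{\mathbb R^d}(u(x)-u(y))\nu(x-y)\,dy$, $\mathcal Nu(y)=\int_D(u(y)-u(x))\nu(x-y)\,dx$ for $y\in D^c$. The function $\beta:D^c\to(0,\infty)$ is such that $\beta\tilde\nu^{-1}$ is essentially bounded and non-trivial, where $\tilde\nu(x)=\int_B\min(1,\nu(x-y))\,dy$ for a bounded open set $B$. $(\mu_1,\psi_1)$ is the first eigenpair of $\mathcal L\psi=\mu\psi$ in $D$, $\mathcal N\psi+\beta\psi=0$ on $D^c$; $\mu_1>0$, $\psi_1>0$ and $\int_D\psi_1\,dx=1$.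 Noise: on a filtered probability space, $B$ is a real Brownian motion and $B^H$ a real fractional Brownian motion with Hurst index $H\in(1/2,1)$; $a(\cdot),b(\cdot),k(\cdot)$ are positive functions of time; $N_t=\int_0^ta(s)\,dB_s+\int_0^tb(s)\,dB^H_s$ (Itô integral with respect to $B$, pathwise Riemann–Stieltjes/Young integral with respect to $B^H$). $K(t)=\frac12\int_0^tk^2(s)\,ds$, $A(t)=\frac12\int_0^ta^2(s)\,ds$. $\lambda,\gamma>0$ are constants, $\zeta>0$ is a function on $\bar D$, $\zeta_m=\min_{\bar D}\zeta>0$. The nonlinearity $g:D\times(0,\infty)\to\mathbb R$ satisfies $g(x,z)\to+\infty$ as $z\to0$ and $g(x,z)<0$ for $z$ large. The initial datum satisfies $0\le z_0<1$, and $v_0=z_0$. (S): $dz=(-\frac12k^2(t)\mathcal Lz-g(x,z))dt-z\,dN_t$ in $D$, $t>0$; $\mathcal Nz+\beta z=0$ on $D^c$; $z(\cdot,0)=z_0$. (R): $\partial_tv=-\frac12k^2(t)\mathcal Lv-\frac12a^2(t)v-e^{N_t}g(x,e^{-N_t}v)$ in $D$, $t>0$; $\mathcal Nv+\beta v=0$ on $D^c$; $v(\cdot,0)=z_0$. Weak solution of (R): for all $\phi\in D(\mathcal L)$ (domain of the self-adjoint realization of $\mathcal L$ on $L^2(D)$ with the Robin exterior condition), $\langle v(t),\phi\rangle_D=\langle z_0,\phi\rangle_D+\int_0^t\big(-\frac12k^2(s)\langle v(s),\mathcal L\phi\rangle_D-\frac12a^2(s)\langle v(s),\phi\rangle_D-e^{N_s}\langle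 g(\cdot,e^{-N_s}v(s)),\phi\rangle_D\big)ds$. Solutions are considered (as positive functions) up to their quenching time. $z$ is a weak solution of (S) iff $v=e^{N_t}z$ is a weak solution of (R). Quenching: a stopping time $\tau$ with values in $(0,\infty]$ is a quenching time of $z$ if $\lim_{t\to\tau}\inf_{x\in D}|z(x,t)|=0$ a.s. on $\{\tau<\infty\}$; $\tau=+\infty$ if $\tau>t$ for all $t>0$. Similarly for $v$. *)

theory Defs
  imports "HOL-Probability.Probability"
begin

section \<open>The domain and the nonlocal operators\<close>

text \<open>
  Near each boundary point, \<open>D\<close> is the part of a ball above the graph of a Lipschitz function of
  the coordinates orthogonal to a unit vector \<open>e\<close>.  A Lipschitz function on the hyperplane
  orthogonal to \<open>e\<close> is encoded as a Lipschitz function \<open>h\<close> on the whole space, evaluated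
  only at orthogonal projections.
\<close>

definition lipschitz_boundary :: "'x::euclidean_space set \<Rightarrow> bool" where
  "lipschitz_boundary D \<longleftrightarrow>
     (\<forall>p\<in>frontier D. \<exists>r>0. \<exists>e. norm e = 1 \<and> (\<exists>h C. C-lipschitz_on UNIV (h :: 'x \<Rightarrow> real) \<and>
        D \<inter> ball p r = {x \<in> ball p r. h (x - (x \<bullet> e) *\<^sub>R e) < x \<bullet> e}))"

definition symmetric_levy_density :: "('x::euclidean_space \<Rightarrow> real) \<Rightarrow> bool" where
  "symmetric_levy_density \<nu> \<longleftrightarrow>
     \<nu> \<in> borel_measurable borel \<and> (\<forall>h. 0 \<le> \<nu> h) \<and> (\<forall>h. \<nu> (- h) = \<nu> h) \<and>
     integrable lborel (\<lambda>h. min 1 ((norm h)\<^sup>2) * \<nu> h)"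

text \<open>The principal value is the limit of the integrals over the complements of small balls.\<close>

definition levy_op :: "('x::euclidean_space \<Rightarrow> real) \<Rightarrow> ('x \<Rightarrow> real) \<Rightarrow> 'x \<Rightarrow> real" where
  "levy_op \<nu> u x =
     Lim (at_right 0) (\<lambda>\<epsilon>. LINT y:{y. \<epsilon> < dist x y}|lborel. (u x - u y) * \<nu> (x - y))"

definition nonlocal_normal ::
  "('x::euclidean_space \<Rightarrow> real) \<Rightarrow> 'x set \<Rightarrow> ('x \<Rightarrow> real) \<Rightarrow> 'x \<Rightarrow> real" where
  "nonlocal_normal \<nu> D u y = (LINT x:D|lborel. (u y - u x) * \<nu> (x - y))"

definition nu_tilde :: "('x::euclidean_space \<Rightarrow> real) \<Rightarrow> 'x set \<Rightarrow> 'x \<Rightarrow> real" where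
  "nu_tilde \<nu> B x = (LINT y:B|lborel. min 1 (\<nu> (x - y)))"

definition robin_coefficient ::
  "('x::euclidean_space \<Rightarrow> real) \<Rightarrow> 'x set \<Rightarrow> 'x set \<Rightarrow> ('x \<Rightarrow> real) \<Rightarrow> bool" where
  "robin_coefficient \<nu> D B \<beta> \<longleftrightarrow>
     \<beta> \<in> borel_measurable borel \<and> (\<forall>y\<in>- D. 0 < \<beta> y) \<and>
     (\<exists>C. AE y in lborel. y \<in> - D \<longrightarrow>
        0 < nu_tilde \<nu> B y \<and> \<beta> y * inverse (nu_tilde \<nu> B y) \<le> C) \<and>
     \<not> (AE y in lborel. y \<in> - D \<longrightarrow> \<beta> y * inverse (nu_tilde \<nu> B y) = 0)"

section \<open>The self-adjoint Robin realization\<close>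

definition L2_on :: "'x::euclidean_space set \<Rightarrow> ('x \<Rightarrow> real) \<Rightarrow> bool" where
  "L2_on D u \<longleftrightarrow> set_borel_measurable lborel D u \<and> set_integrable lborel D (\<lambda>x. (u x)\<^sup>2)"

definition inner_on :: "'x::euclidean_space set \<Rightarrow> ('x \<Rightarrow> real) \<Rightarrow> ('x \<Rightarrow> real) \<Rightarrow> real" where
  "inner_on D u w = (LINT x:D|lborel. u x * w x)"

definition energy_dom :: "'x::euclidean_space set \<Rightarrow> ('x \<times> 'x) set" where
  "energy_dom D = - ((- D) \<times> (- D))"

definition energy ::
  "('x::euclidean_space \<Rightarrow> real) \<Rightarrow> 'x set \<Rightarrow> ('x \<Rightarrow> real) \<Rightarrow> ('x \<Rightarrow> real) \<Rightarrow> real" where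
  "energy \<nu> D u w =
     (1/2) * (LINT p:energy_dom D|(lborel \<Otimes>\<^sub>M lborel).
        (u (fst p) - u (snd p)) * (w (fst p) - w (snd p)) * \<nu> (fst p - snd p))"

definition form_domain ::
  "('x::euclidean_space \<Rightarrow> real) \<Rightarrow> 'x set \<Rightarrow> ('x \<Rightarrow> real) \<Rightarrow> ('x \<Rightarrow> real) set" where
  "form_domain \<nu> D \<beta> =
     {u. u \<in> borel_measurable borel \<and> L2_on D u \<and>
         set_integrable (lborel \<Otimes>\<^sub>M lborel) (energy_dom D)
           (\<lambda>p. (u (fst p) - u (snd p))\<^sup>2 * \<nu> (fst p - snd p)) \<and>
         set_integrable lborel (- D) (\<lambda>y. \<beta> y * (u y)\<^sup>2)}"

definition C2_compactly_supported :: "'x::euclidean_space set \<Rightarrow> ('x \<Rightarrow> real) set" where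
  "C2_compactly_supported D =
     {w. (\<exists>G H. (\<forall>x. (w has_derivative (\<lambda>h. G x \<bullet> h)) (at x)) \<and>
                (\<forall>x. ((G :: 'x \<Rightarrow> 'x) has_derivative blinfun_apply (H x)) (at x)) \<and>
                continuous_on UNIV H) \<and>
         compact (closure {x. w x \<noteq> 0}) \<and> closure {x. w x \<noteq> 0} \<subseteq> D}"

text \<open>
  \<open>robin_realization \<nu> D \<beta> u f\<close> says that \<open>u\<close> (given on the whole space) lies in the domain of
  the self-adjoint realization on \<open>L\<^sup>2(D)\<close> of the operator \<open>levy_op \<nu>\<close> with exterior condition
  \<open>\<N>u + \<beta>u = 0\<close>, and that this realization maps \<open>u\<close> to \<open>f\<close>.  It is the operator associated with
  the closed form
    \<open>(u, w) \<mapsto> energy \<nu> D u w + \<integral>\<^bsub>-D\<^esub> \<beta> u w\<close>,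
  whose shape comes from the Gauss-Green formula
    \<open>\<integral>\<^bsub>D\<^esub> (\<L>u) w = energy \<nu> D u w - \<integral>\<^bsub>-D\<^esub> (\<N>u) w\<close>.
  The last conjunct determines the operator; the two conjuncts before it are consequences of it
  (test with \<open>w\<close> supported in \<open>D\<close>, respectively outside \<open>closure D\<close>), and exhibit the
  relation to the principal value operator (\<open>\<L>u = f\<close> in \<open>D\<close>, in the sense of distributions) and to
  the exterior condition.  Pointwise existence of the principal value of \<open>u\<close> itself is not required,
  since functions in the domain need not be regular enough.
\<close>

definition robin_realization ::
  "('x::euclidean_space \<Rightarrow> real) \<Rightarrow> 'x set \<Rightarrow> ('x \<Rightarrow> real) \<Rightarrow> ('x \<Rightarrow> real) \<Rightarrow> ('x \<Rightarrow> real) \<Rightarrow> bool" where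
  "robin_realization \<nu> D \<beta> u f \<longleftrightarrow>
     u \<in> form_domain \<nu> D \<beta> \<and> L2_on D f \<and>
     (\<forall>w\<in>C2_compactly_supported D.
        has_bochner_integral lborel (\<lambda>x. u x * levy_op \<nu> w x) (inner_on D f w)) \<and>
     (AE y in lborel. y \<in> - D \<longrightarrow> nonlocal_normal \<nu> D u y + \<beta> y * u y = 0) \<and>
     (\<forall>w\<in>form_domain \<nu> D \<beta>.
        energy \<nu> D u w + (LINT y:(- D)|lborel. \<beta> y * u y * w y) = inner_on D f w)"

definition eigenpair ::
  "('x::euclidean_space \<Rightarrow> real) \<Rightarrow> 'x set \<Rightarrow> ('x \<Rightarrow> real) \<Rightarrow> real \<Rightarrow> ('x \<Rightarrow> real) \<Rightarrow> bool" where
  "eigenpair \<nu> D \<beta> \<mu> \<psi> \<longleftrightarrow>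
     robin_realization \<nu> D \<beta> \<psi> (\<lambda>x. \<mu> * \<psi> x) \<and> \<not> (AE x in lborel. x \<in> D \<longrightarrow> \<psi> x = 0)"

definition first_eigenpair ::
  "('x::euclidean_space \<Rightarrow> real) \<Rightarrow> 'x set \<Rightarrow> ('x \<Rightarrow> real) \<Rightarrow> real \<Rightarrow> ('x \<Rightarrow> real) \<Rightarrow> bool" where
  "first_eigenpair \<nu> D \<beta> \<mu>1 \<psi>1 \<longleftrightarrow>
     eigenpair \<nu> D \<beta> \<mu>1 \<psi>1 \<and> (\<forall>\<mu> \<phi>. eigenpair \<nu> D \<beta> \<mu> \<phi> \<longrightarrow> \<mu>1 \<le> \<mu>) \<and>
     0 < \<mu>1 \<and> (\<forall>x\<in>D. 0 < \<psi>1 x) \<and> set_integrable lborel D \<psi>1 \<and> (LINT x:D|lborel. \<psi>1 x) = 1"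

section \<open>The noise\<close>

text \<open>Processes are indexed by \<open>real\<close>, but only nonnegative times matter.\<close>

definition filtered_prob_space :: "'w measure \<Rightarrow> (real \<Rightarrow> 'w measure) \<Rightarrow> bool" where
  "filtered_prob_space M F \<longleftrightarrow>
     prob_space M \<and> filtration (space M) F \<and> (\<forall>t. subalgebra M (F t))"

definition adapted_process :: "(real \<Rightarrow> 'w measure) \<Rightarrow> (real \<Rightarrow> 'w \<Rightarrow> real) \<Rightarrow> bool" where
  "adapted_process F X \<longleftrightarrow> (\<forall>t\<ge>0. X t \<in> borel_measurable (F t))"

definition continuous_paths :: "'w measure \<Rightarrow> (real \<Rightarrow> 'w \<Rightarrow> real) \<Rightarrow> bool" where
  "continuous_paths M X \<longleftrightarrow> (AE \<omega> in M. continuous_on {0..} (\<lambda>t. X t \<omega>))"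

definition brownian_motion ::
  "'w measure \<Rightarrow> (real \<Rightarrow> 'w measure) \<Rightarrow> (real \<Rightarrow> 'w \<Rightarrow> real) \<Rightarrow> bool" where
  "brownian_motion M F W \<longleftrightarrow>
     adapted_process F W \<and> continuous_paths M W \<and> (AE \<omega> in M. W 0 \<omega> = 0) \<and>
     (\<forall>s t. 0 \<le> s \<longrightarrow> s < t \<longrightarrow>
        distributed M lborel (\<lambda>\<omega>. W t \<omega> - W s \<omega>) (\<lambda>x. ennreal (normal_density 0 (sqrt (t - s)) x)) \<and>
        prob_space.indep_set M (sets (F s))
          (sets (vimage_algebra (space M) (\<lambda>\<omega>. W t \<omega> - W s \<omega>) borel)))"

definition centered_gaussian :: "'w measure \<Rightarrow> ('w \<Rightarrow> real) \<Rightarrow> bool" where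
  "centered_gaussian M X \<longleftrightarrow>
     (AE \<omega> in M. X \<omega> = 0) \<or>
     (\<exists>\<sigma>>0. distributed M lborel X (\<lambda>x. ennreal (normal_density 0 \<sigma> x)))"

definition fractional_brownian_motion ::
  "'w measure \<Rightarrow> (real \<Rightarrow> 'w measure) \<Rightarrow> real \<Rightarrow> (real \<Rightarrow> 'w \<Rightarrow> real) \<Rightarrow> bool" where
  "fractional_brownian_motion M F H X \<longleftrightarrow>
     adapted_process F X \<and> continuous_paths M X \<and>
     (\<forall>S c. finite S \<longrightarrow> S \<subseteq> {0..} \<longrightarrow> centered_gaussian M (\<lambda>\<omega>. \<Sum>s\<in>S. c s * X s \<omega>)) \<and>
     (\<forall>s\<ge>0. \<forall>t\<ge>0. (LINT \<omega>|M. X s \<omega> * X t \<omega>) =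
        (1/2) * (s powr (2 * H) + t powr (2 * H) - \<bar>t - s\<bar> powr (2 * H)))"

text \<open>
  Elementary integrands \<open>\<Sum>i<n. \<xi>\<^sub>i 1\<^bsub>(r\<^sub>i, r\<^sub>i\<^sub>+\<^sub>1]\<^esub>\<close> on \<open>[0,T]\<close>, with bounded \<open>F(r\<^sub>i)\<close>-measurable
  \<open>\<xi>\<^sub>i\<close>.
\<close>

definition elementary_integrand ::
  "(real \<Rightarrow> 'w measure) \<Rightarrow> real \<Rightarrow> nat \<Rightarrow> (nat \<Rightarrow> real) \<Rightarrow> (nat \<Rightarrow> 'w \<Rightarrow> real) \<Rightarrow> bool" where
  "elementary_integrand F T n r \<xi> \<longleftrightarrow>
     0 \<le> r 0 \<and> (\<forall>i<n. r i \<le> r (Suc i)) \<and> r n \<le> T \<and>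
     (\<forall>i<n. \<xi> i \<in> borel_measurable (F (r i)) \<and> (\<exists>C. \<forall>\<omega>. \<bar>\<xi> i \<omega>\<bar> \<le> C))"

definition elementary_value ::
  "nat \<Rightarrow> (nat \<Rightarrow> real) \<Rightarrow> (nat \<Rightarrow> 'w \<Rightarrow> real) \<Rightarrow> real \<Rightarrow> 'w \<Rightarrow> real" where
  "elementary_value n r \<xi> s \<omega> = (\<Sum>i<n. \<xi> i \<omega> * indicator {r i<..r (Suc i)} s)"

definition elementary_integral ::
  "(real \<Rightarrow> 'w \<Rightarrow> real) \<Rightarrow> nat \<Rightarrow> (nat \<Rightarrow> real) \<Rightarrow> (nat \<Rightarrow> 'w \<Rightarrow> real) \<Rightarrow> 'w \<Rightarrow> real" where
  "elementary_integral W n r \<xi> \<omega> = (\<Sum>i<n. \<xi> i \<omega> * (W (r (Suc i)) \<omega> - W (r i) \<omega>))"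

text \<open>
  \<open>I\<close> is (a continuous version of) the Ito integral process of the square integrable integrand \<open>Y\<close>:
  each \<open>I T\<close> is the mean-square limit of the integrals of elementary integrands converging to \<open>Y\<close>
  in \<open>L\<^sup>2([0,T] \<times> \<Omega>)\<close>.  By the Ito isometry the limit does not depend on the approximating sequence.
\<close>

definition ito_integral_process ::
  "'w measure \<Rightarrow> (real \<Rightarrow> 'w measure) \<Rightarrow> (real \<Rightarrow> 'w \<Rightarrow> real) \<Rightarrow> (real \<Rightarrow> 'w \<Rightarrow> real) \<Rightarrow>
   (real \<Rightarrow> 'w \<Rightarrow> real) \<Rightarrow> bool" where
  "ito_integral_process M F W Y I \<longleftrightarrow>
     adapted_process F I \<and> continuous_paths M I \<and>
     (\<forall>T\<ge>0. \<exists>n r \<xi>. (\<forall>j. elementary_integrand F T (n j) (r j) (\<xi> j)) \<and>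
        ((\<lambda>j. \<integral>\<^sup>+\<omega>. (\<integral>\<^sup>+s\<in>{0..T}. ennreal ((elementary_value (n j) (r j) (\<xi> j) s \<omega> - Y s \<omega>)\<^sup>2) \<partial>lborel) \<partial>M)
           \<longlonglongrightarrow> 0) \<and>
        ((\<lambda>j. \<integral>\<^sup>+\<omega>. ennreal ((elementary_integral W (n j) (r j) (\<xi> j) \<omega> - I T \<omega>)\<^sup>2) \<partial>M)
           \<longlonglongrightarrow> 0))"

text \<open>
  Riemann-Stieltjes integral \<open>\<integral>\<^bsub>[c,d]\<^esub> f dh = J\<close> as a limit over tagged partitions as the mesh tends
  to \<open>0\<close>; for Hoelder continuous \<open>f\<close>, \<open>h\<close> with exponents summing to more than \<open>1\<close> this is the
  Young integral.
\<close>

definition has_RS_integral ::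
  "(real \<Rightarrow> real) \<Rightarrow> (real \<Rightarrow> real) \<Rightarrow> real \<Rightarrow> real \<Rightarrow> real \<Rightarrow> bool" where
  "has_RS_integral f h c d J \<longleftrightarrow>
     (\<forall>\<epsilon>>0. \<exists>\<delta>>0. \<forall>n r \<xi>. r 0 = c \<and> r n = d \<and>
        (\<forall>i<n. r i \<le> \<xi> i \<and> \<xi> i \<le> r (Suc i) \<and> r (Suc i) - r i < \<delta>) \<longrightarrow>
        \<bar>(\<Sum>i<n. f (\<xi> i) * (h (r (Suc i)) - h (r i))) - J\<bar> < \<epsilon>)"

text \<open>\<open>N\<^sub>t = \<integral>\<^bsub>[0,t]\<^esub> a dW + \<integral>\<^bsub>[0,t]\<^esub> b dX\<close>, the first integral being Ito, the second pathwise.\<close>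

definition mixed_noise ::
  "'w measure \<Rightarrow> (real \<Rightarrow> 'w measure) \<Rightarrow> (real \<Rightarrow> real) \<Rightarrow> (real \<Rightarrow> real) \<Rightarrow>
   (real \<Rightarrow> 'w \<Rightarrow> real) \<Rightarrow> (real \<Rightarrow> 'w \<Rightarrow> real) \<Rightarrow> (real \<Rightarrow> 'w \<Rightarrow> real) \<Rightarrow> bool" where
  "mixed_noise M F a b W X N \<longleftrightarrow>
     adapted_process F N \<and>
     (\<exists>I. ito_integral_process M F W (\<lambda>s _. a s) I \<and>
        (AE \<omega> in M. \<forall>t\<ge>0. has_RS_integral b (\<lambda>s. X s \<omega>) 0 t (N t \<omega> - I t \<omega>)))"

section \<open>Weak solutions and quenching\<close>

definition half_sq_integral :: "(real \<Rightarrow> real) \<Rightarrow> real \<Rightarrow> real" where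
  "half_sq_integral f t = (1/2) * (LINT s:{0..t}|lborel. (f s)\<^sup>2)"

definition rhs_R ::
  "'x::euclidean_space set \<Rightarrow> ('x \<Rightarrow> real \<Rightarrow> real) \<Rightarrow> (real \<Rightarrow> real) \<Rightarrow> (real \<Rightarrow> real) \<Rightarrow>
   (real \<Rightarrow> real) \<Rightarrow> (real \<Rightarrow> 'x \<Rightarrow> real) \<Rightarrow> ('x \<Rightarrow> real) \<Rightarrow> ('x \<Rightarrow> real) \<Rightarrow> real \<Rightarrow> real" where
  "rhs_R D g k a n v \<phi> L\<phi> s =
     - (1/2) * (k s)\<^sup>2 * inner_on D (v s) L\<phi>
     - (1/2) * (a s)\<^sup>2 * inner_on D (v s) \<phi>
     - exp (n s) * inner_on D (\<lambda>x. g x (exp (- n s) * v s x)) \<phi>"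

text \<open>
  Pathwise weak solutions on \<open>[0,T)\<close>, where \<open>T\<close> may be infinite; \<open>n\<close> is a path of the noise.  The
  integrability requirements say that the integrals in the weak formulation make sense.
\<close>

definition weak_solution_R ::
  "('x::euclidean_space \<Rightarrow> real) \<Rightarrow> 'x set \<Rightarrow> ('x \<Rightarrow> real) \<Rightarrow> ('x \<Rightarrow> real \<Rightarrow> real) \<Rightarrow>
   (real \<Rightarrow> real) \<Rightarrow> (real \<Rightarrow> real) \<Rightarrow> (real \<Rightarrow> real) \<Rightarrow> ('x \<Rightarrow> real) \<Rightarrow> ereal \<Rightarrow>
   (real \<Rightarrow> 'x \<Rightarrow> real) \<Rightarrow> bool" where
  "weak_solution_R \<nu> D \<beta> g k a n z0 T v \<longleftrightarrow>
     (\<forall>t\<ge>0. ereal t < T \<longrightarrow> L2_on D (v t)) \<and>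
     (\<forall>\<phi> L\<phi>. robin_realization \<nu> D \<beta> \<phi> L\<phi> \<longrightarrow> (\<forall>t\<ge>0. ereal t < T \<longrightarrow>
        (AE s in lborel. 0 < s \<and> s < t \<longrightarrow>
           set_integrable lborel D (\<lambda>x. g x (exp (- n s) * v s x) * \<phi> x)) \<and>
        set_integrable lborel {0..t} (rhs_R D g k a n v \<phi> L\<phi>) \<and>
        inner_on D (v t) \<phi> =
          inner_on D z0 \<phi> + (LINT s:{0..t}|lborel. rhs_R D g k a n v \<phi> L\<phi> s)))"

definition weak_solution_S ::
  "('x::euclidean_space \<Rightarrow> real) \<Rightarrow> 'x set \<Rightarrow> ('x \<Rightarrow> real) \<Rightarrow> ('x \<Rightarrow> real \<Rightarrow> real) \<Rightarrow>
   (real \<Rightarrow> real) \<Rightarrow> (real \<Rightarrow> real) \<Rightarrow> (real \<Rightarrow> real) \<Rightarrow> ('x \<Rightarrow> real) \<Rightarrow> ereal \<Rightarrow>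
   (real \<Rightarrow> 'x \<Rightarrow> real) \<Rightarrow> bool" where
  "weak_solution_S \<nu> D \<beta> g k a n z0 T z \<longleftrightarrow>
     weak_solution_R \<nu> D \<beta> g k a n z0 T (\<lambda>t x. exp (n t) * z t x)"

definition positive_until :: "'x set \<Rightarrow> ereal \<Rightarrow> (real \<Rightarrow> 'x \<Rightarrow> real) \<Rightarrow> bool" where
  "positive_until D T u \<longleftrightarrow> (\<forall>t>0. ereal t < T \<longrightarrow> (\<forall>x\<in>D. 0 < u t x))"

definition quenches_at :: "'x set \<Rightarrow> (real \<Rightarrow> 'x \<Rightarrow> real) \<Rightarrow> real \<Rightarrow> bool" where
  "quenches_at D u T \<longleftrightarrow> ((\<lambda>t. INF x\<in>D. \<bar>u t x\<bar>) \<longlongrightarrow> 0) (at_left T)"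

text \<open>The library's \<open>stopping_time\<close> forces the index type of the filtration on the values.\<close>

definition ext_stopping_time :: "(real \<Rightarrow> 'w measure) \<Rightarrow> ('w \<Rightarrow> ereal) \<Rightarrow> bool" where
  "ext_stopping_time F \<tau> \<longleftrightarrow> (\<forall>t\<ge>0. Measurable.pred (F t) (\<lambda>\<omega>. \<tau> \<omega> \<le> ereal t))"

definition quenching_time ::
  "'w measure \<Rightarrow> (real \<Rightarrow> 'w measure) \<Rightarrow> 'x set \<Rightarrow> ('w \<Rightarrow> real \<Rightarrow> 'x \<Rightarrow> real) \<Rightarrow> ('w \<Rightarrow> ereal) \<Rightarrow> bool" where
  "quenching_time M F D u \<tau> \<longleftrightarrow>
     ext_stopping_time F \<tau> \<and> (\<forall>\<omega>\<in>space M. 0 < \<tau> \<omega>) \<and>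
     (AE \<omega> in M. \<tau> \<omega> < \<infinity> \<longrightarrow> quenches_at D (u \<omega>) (real_of_ereal (\<tau> \<omega>)))"

text \<open>\<open>n\<close> is a path of the noise and \<open>y0\<close> stands for the inner product of the initial datum with \<open>\<psi>\<^sub>1\<close>.\<close>

definition tau_star ::
  "real \<Rightarrow> real \<Rightarrow> real \<Rightarrow> real \<Rightarrow> real \<Rightarrow> (real \<Rightarrow> real) \<Rightarrow> (real \<Rightarrow> real) \<Rightarrow> real \<Rightarrow>
   (real \<Rightarrow> real) \<Rightarrow> ereal" where
  "tau_star \<eta>1 \<gamma> lam \<zeta>m \<mu>1 k a y0 n =
     Inf {ereal t | t. 0 < t \<and>
       (LINT s:{0..t}|lborel.
          exp (- 3 * (\<eta>1 * \<gamma> * s - \<mu>1 * half_sq_integral k s - half_sq_integral a s) + 3 * n s))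
       \<ge> y0 ^ 3 / (3 * lam * \<eta>1 * \<zeta>m)}"

end

theory Submission
  imports Defs
begin

text \<open>
  The argument is pathwise and reduces the equation to a scalar differential inequality.  Project the
  solution on the first eigenfunction, \<open>y(t) = \<langle>v(t), \<psi>\<^sub>1\<rangle>\<close>.  The operator acts on \<open>\<psi>\<^sub>1\<close> by
  \<open>\<mu>\<^sub>1\<close>, and since \<open>\<psi>\<^sub>1\<close> is a probability density on \<open>D\<close>, Jensen's inequality for
  \<open>u \<mapsto> u\<^sup>-\<^sup>2\<close> bounds the projected reaction from below by the same expression in \<open>y\<close>
  (\<open>singular_reaction_projection\<close>).  With \<open>P(t) = \<eta>\<^sub>1\<gamma>t - \<mu>\<^sub>1K(t) - A(t)\<close> this gives
    \<open>y' \<le> P' y - \<lambda>\<eta>\<^sub>1\<zeta>\<^sub>m e\<^bsup>3N\<^esup> y\<^sup>-\<^sup>2\<close>,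
  and hence, for the cube of \<open>e\<^bsup>-P\<^esup> y\<close>,
    \<open>e\<^bsup>-3P(t)\<^esup> y(t)\<^sup>3 \<le> y(0)\<^sup>3 - 3\<lambda>\<eta>\<^sub>1\<zeta>\<^sub>m \<integral> e\<^bsup>-3P+3N\<^esup> ds\<close>,  the integral being over \<open>[0,t]\<close>
  (\<open>cube_decay\<close>, \<open>projected_solution_decay\<close>).  As long as the solution exists and is positive,
  the left side is positive, so the integral stays strictly below the threshold that defines the
  stopping time.  Thus no time before \<open>\<tau>\<close> is admitted in that definition, that is, \<open>\<tau> \<le> \<tau>\<^sup>*\<close>;
  when \<open>\<tau>\<^sup>* < \<infinity>\<close> this makes \<open>\<tau>\<close> finite, and at a finite \<open>\<tau>\<close> the solution quenches.

  Two analytic points need care.  The coefficients are only square integrable in time, so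
  \<open>y\<close> and \<open>P\<close> are merely absolutely continuous and the inequality has to be integrated with a
  chain rule for indefinite Lebesgue integrals (\<open>is_indefinite_integral_chain\<close>).  And \<open>v\<close> and
  \<open>z = e\<^bsup>-N\<^esup> v\<close> quench together because \<open>N\<close> has continuous paths, which requires that a
  Riemann--Stieltjes integral depends continuously on its upper end point
  (\<open>RS_integral_continuous\<close>).
\<close>

section \<open>Riemann--Stieltjes integrals as functions of the upper end point\<close>

text \<open>
The values of the Riemann--Stieltjes sums over tagged partitions of \<open>[c,d]\<close> with mesh below
\<open>\<delta>\<close>.  Building a partition by adding intervals on the right makes concatenation an induction,
with no arithmetic on the indices of the partition points.
\<close>

inductive RS_sum :: "(real \<Rightarrow> real) \<Rightarrow> (real \<Rightarrow> real) \<Rightarrow> real \<Rightarrow> real \<Rightarrow> real \<Rightarrow> real \<Rightarrow> bool"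
  for f h \<delta> where
  RS_sum_refl: "RS_sum f h \<delta> c c 0"
| RS_sum_step: "RS_sum f h \<delta> c d S \<Longrightarrow> d \<le> \<xi> \<Longrightarrow> \<xi> \<le> e \<Longrightarrow> e - d < \<delta> \<Longrightarrow>
    RS_sum f h \<delta> c e (S + f \<xi> * (h e - h d))"

lemma RS_sum_mono: "RS_sum f h \<delta> c d S \<Longrightarrow> \<delta> \<le> \<delta>' \<Longrightarrow> RS_sum f h \<delta>' c d S"
  by (induction rule: RS_sum.induct) (auto intro: RS_sum.intros)

lemma RS_sum_append:
  assumes "RS_sum f h \<delta> d e S'" and "RS_sum f h \<delta> c d S"
  shows "RS_sum f h \<delta> c e (S + S')"
  using assms
proof (induction rule: RS_sum.induct)
  case (RS_sum_step c' d' S' \<xi> e)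
  from RS_sum.RS_sum_step[OF RS_sum_step.IH[OF RS_sum_step.prems] RS_sum_step.hyps(2-4)]
  show ?case by (simp add: algebra_simps)
qed simp

lemma RS_sum_single: "d \<le> \<xi> \<Longrightarrow> \<xi> \<le> e \<Longrightarrow> e - d < \<delta> \<Longrightarrow> RS_sum f h \<delta> d e (f \<xi> * (h e - h d))"
  using RS_sum_step[OF RS_sum_refl] by force

lemma RS_sum_exists:
  assumes "c \<le> d" "0 < \<delta>"
  shows "\<exists>S. RS_sum f h \<delta> c d S"
proof -
  have "c \<le> d \<Longrightarrow> d - c \<le> real n * (\<delta> / 2) \<Longrightarrow> \<exists>S. RS_sum f h \<delta> c d S" for n d
  proof (induction n arbitrary: d)
    case 0
    then show ?case using RS_sum_refl[of f h \<delta> c] by auto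
  next
    case (Suc n)
    define d' where "d' = max c (d - \<delta> / 2)"
    have d': "c \<le> d'" "d' - c \<le> real n * (\<delta> / 2)" "d' \<le> d" "d - d' < \<delta>"
      using Suc.prems \<open>0 < \<delta>\<close> by (auto simp: d'_def max_def algebra_simps)
    obtain S where "RS_sum f h \<delta> c d' S"
      using Suc.IH[OF d'(1,2)] by blast
    from RS_sum_step[OF this order_refl d'(3,4)] show ?case by blast
  qed
  moreover obtain n where "(d - c) / (\<delta> / 2) \<le> real n"
    using real_arch_simple by blast
  ultimately show ?thesis
    using assms by (simp add: field_simps)
qed

lemma RS_sum_imp_partition:
  assumes "RS_sum f h \<delta> c d S"
  shows "\<exists>n r \<xi>. r 0 = c \<and> r n = d \<and>
    (\<forall>i<n. r i \<le> \<xi> i \<and> \<xi> i \<le> r (Suc i) \<and> r (Suc i) - r i < \<delta>) \<and>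
    S = (\<Sum>i<n. f (\<xi> i) * (h (r (Suc i)) - h (r i)))"
  using assms
proof (induction rule: RS_sum.induct)
  case (RS_sum_refl c)
  show ?case by (rule exI[of _ 0], rule exI[of _ "\<lambda>_. c"]) simp
next
  case (RS_sum_step c d S x e)
  then obtain n r \<xi> where *: "r 0 = c" "r n = d"
    "\<forall>i<n. r i \<le> \<xi> i \<and> \<xi> i \<le> r (Suc i) \<and> r (Suc i) - r i < \<delta>"
    "S = (\<Sum>i<n. f (\<xi> i) * (h (r (Suc i)) - h (r i)))"
    by blast
  let ?r = "r(Suc n := e)" and ?\<xi> = "\<xi>(n := x)"
  have "(\<Sum>i<n. f (?\<xi> i) * (h (?r (Suc i)) - h (?r i))) = S"
    unfolding *(4) by (intro sum.cong) auto
  then have "S + f x * (h e - h d) = (\<Sum>i<Suc n. f (?\<xi> i) * (h (?r (Suc i)) - h (?r i)))"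
    using *(2) by simp
  moreover have "\<forall>i<Suc n. ?r i \<le> ?\<xi> i \<and> ?\<xi> i \<le> ?r (Suc i) \<and> ?r (Suc i) - ?r i < \<delta>"
    using * RS_sum_step.hyps by (auto simp: less_Suc_eq)
  ultimately show ?case
    using *(1) by (intro exI[of _ "Suc n"] exI[of _ ?r] exI[of _ ?\<xi>]) auto
qed

lemma has_RS_integral_sum:
  assumes "has_RS_integral f h c d J" "0 < \<epsilon>"
  obtains \<delta> where "0 < \<delta>" "\<And>S. RS_sum f h \<delta> c d S \<Longrightarrow> \<bar>S - J\<bar> < \<epsilon>"
proof -
  from assms obtain \<delta> where "0 < \<delta>" and
    \<delta>: "\<And>n r \<xi>. r 0 = c \<and> r n = d \<and>
        (\<forall>i<n. r i \<le> \<xi> i \<and> \<xi> i \<le> r (Suc i) \<and> r (Suc i) - r i < \<delta>) \<Longrightarrow>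
        \<bar>(\<Sum>i<n. f (\<xi> i) * (h (r (Suc i)) - h (r i))) - J\<bar> < \<epsilon>"
    unfolding has_RS_integral_def by meson
  have "\<bar>S - J\<bar> < \<epsilon>" if "RS_sum f h \<delta> c d S" for S
    using RS_sum_imp_partition[OF that] \<delta> by blast
  with \<open>0 < \<delta>\<close> show ?thesis by (rule that)
qed

text \<open>
The one \<open>\<delta>\<close> chosen for \<open>[0,T]\<close> controls all short subintervals \<open>[s,t]\<close>: two partitions of
\<open>[0,T]\<close> that agree outside \<open>[s,t]\<close> have sums that are close to the same number, so their
contributions on \<open>[s,t]\<close> are close to each other.
\<close>

lemma RS_integral_increment:
  assumes J: "\<And>t. 0 \<le> t \<Longrightarrow> has_RS_integral f h 0 t (J t)" and "0 < \<epsilon>" "0 \<le> T"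
  obtains \<delta> where "0 < \<delta>"
    "\<And>s t \<xi>. \<lbrakk>0 \<le> s; s \<le> \<xi>; \<xi> \<le> t; t \<le> T; t - s < \<delta>\<rbrakk> \<Longrightarrow>
       \<bar>J t - J s - f \<xi> * (h t - h s)\<bar> < \<epsilon>"
proof -
  have e: "0 < \<epsilon> / 4" using \<open>0 < \<epsilon>\<close> by simp
  obtain \<delta> where \<delta>: "0 < \<delta>" "\<And>S. RS_sum f h \<delta> 0 T S \<Longrightarrow> \<bar>S - J T\<bar> < \<epsilon> / 4"
    using has_RS_integral_sum[OF J[OF \<open>0 \<le> T\<close>] e] by blast
  have "\<bar>J t - J s - f \<xi> * (h t - h s)\<bar> < \<epsilon>"
    if st: "0 \<le> s" "s \<le> \<xi>" "\<xi> \<le> t" "t \<le> T" "t - s < \<delta>" for s t \<xi>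
  proof -
    have "0 \<le> t" using st by linarith
    obtain \<delta>s where \<delta>s: "0 < \<delta>s" "\<And>S. RS_sum f h \<delta>s 0 s S \<Longrightarrow> \<bar>S - J s\<bar> < \<epsilon> / 4"
      using has_RS_integral_sum[OF J[OF \<open>0 \<le> s\<close>] e] by blast
    obtain \<delta>t where \<delta>t: "0 < \<delta>t" "\<And>S. RS_sum f h \<delta>t 0 t S \<Longrightarrow> \<bar>S - J t\<bar> < \<epsilon> / 4"
      using has_RS_integral_sum[OF J[OF \<open>0 \<le> t\<close>] e] by blast
    define d where "d = min \<delta> (min \<delta>s \<delta>t)"
    have d: "0 < d" "d \<le> \<delta>" "d \<le> \<delta>s" "d \<le> \<delta>t"
      using \<delta> \<delta>s \<delta>t by (auto simp: d_def)
    obtain A B C where ABC: "RS_sum f h d 0 s A" "RS_sum f h d s t B" "RS_sum f h d t T C"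
      using RS_sum_exists[OF _ d(1)] st by (meson order_trans)
    \<comment> \<open>Two partitions of \<open>[0,T]\<close> that differ on \<open>[s,t]\<close> only: there the first is fine and the
      second is the single interval with tag \<open>\<xi>\<close>.\<close>
    have "\<bar>A + B + C - J T\<bar> < \<epsilon> / 4"
      by (intro \<delta>(2) RS_sum_append[where d = t] RS_sum_append[where d = s] ABC[THEN RS_sum_mono] d)
    moreover have "\<bar>A + f \<xi> * (h t - h s) + C - J T\<bar> < \<epsilon> / 4"
      by (intro \<delta>(2) RS_sum_append[where d = t] RS_sum_append[where d = s] RS_sum_single
          ABC[THEN RS_sum_mono] d st)
    moreover have "\<bar>A - J s\<bar> < \<epsilon> / 4"
      by (intro \<delta>s(2) ABC[THEN RS_sum_mono] d)
    moreover have "\<bar>A + B - J t\<bar> < \<epsilon> / 4"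
      by (intro \<delta>t(2) RS_sum_append[where d = s] ABC[THEN RS_sum_mono] d)
    ultimately show ?thesis by linarith
  qed
  with \<delta>(1) show ?thesis by (rule that)
qed

text \<open>
The integrand may be unbounded near \<open>t0\<close>, but the tag of the short interval between \<open>t0\<close>
and \<open>t\<close> is free: with the tag \<open>t0\<close>, the increment of \<open>J\<close> is compared with
\<open>f t0 * (h t - h t0)\<close>, which is small by continuity of the integrator alone.
\<close>

lemma RS_integral_continuous:
  assumes J: "\<And>t. 0 \<le> t \<Longrightarrow> has_RS_integral f h 0 t (J t)"
    and h: "continuous_on {0..} h"
  shows "continuous_on {0..} J"
  unfolding continuous_on_iff
proof (intro ballI allI impI)
  fix t0 \<epsilon> :: real assume t0: "t0 \<in> {0..}" and "0 < \<epsilon>"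
  obtain \<delta> where \<delta>: "0 < \<delta>"
    "\<And>s t \<xi>. \<lbrakk>0 \<le> s; s \<le> \<xi>; \<xi> \<le> t; t \<le> t0 + 1; t - s < \<delta>\<rbrakk> \<Longrightarrow>
       \<bar>J t - J s - f \<xi> * (h t - h s)\<bar> < \<epsilon> / 2"
    using RS_integral_increment[of f h J "\<epsilon> / 2" "t0 + 1"] J t0 \<open>0 < \<epsilon>\<close> by auto
  have "continuous_on {0..} (\<lambda>t. f t0 * (h t - h t0))"
    by (intro continuous_intros h)
  then obtain d where d: "0 < d"
    "\<And>t. t \<in> {0..} \<Longrightarrow> dist t t0 < d \<Longrightarrow> \<bar>f t0 * (h t - h t0)\<bar> < \<epsilon> / 2"
    unfolding continuous_on_iff dist_real_def using t0 \<open>0 < \<epsilon>\<close>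
    by (metis (no_types, lifting) diff_self diff_zero half_gt_zero mult_zero_right)
  have "dist (J t) (J t0) < \<epsilon>" if t: "t \<in> {0..}" "dist t t0 < min d (min \<delta> 1)" for t
  proof -
    have "\<bar>J t - J t0 - f t0 * (h t - h t0)\<bar> < \<epsilon> / 2"
    proof (cases "t0 \<le> t")
      case True
      then show ?thesis using t t0 by (intro \<delta>(2)) (auto simp: dist_real_def)
    next
      case False
      then have "\<bar>J t0 - J t - f t0 * (h t0 - h t)\<bar> < \<epsilon> / 2"
        using t t0 by (intro \<delta>(2)) (auto simp: dist_real_def)
      then show ?thesis by (simp add: abs_if algebra_simps split: if_splits)
    qed
    moreover have "\<bar>f t0 * (h t - h t0)\<bar> < \<epsilon> / 2"
      using d(2) t by simp
    ultimately show ?thesis unfolding dist_real_def by linarith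
  qed
  then show "\<exists>d>0. \<forall>t\<in>{0..}. dist t t0 < d \<longrightarrow> dist (J t) (J t0) < \<epsilon>"
    using d(1) \<delta>(1) by (intro exI[of _ "min d (min \<delta> 1)"]) auto
qed

section \<open>Absolutely continuous functions as indefinite Lebesgue integrals\<close>

lemma set_integrable_Icc_subset:
  fixes q :: "real \<Rightarrow> real"
  assumes "set_integrable lborel {a..b} q" "a \<le> c" "d \<le> b"
  shows "set_integrable lborel {c..d} q"
  using assms by (intro set_integrable_subset[OF assms(1)]) auto

lemma set_integral_lborel_singleton [simp]:
  fixes q :: "real \<Rightarrow> real"
  shows "(LINT s:{a}|lborel. q s) = 0"
  by (simp add: set_integral_at_point)

lemma set_integral_Icc_combine:
  fixes q :: "real \<Rightarrow> real"
  assumes "set_integrable lborel {a..c} q" "a \<le> b" "b \<le> c"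
  shows "(LINT s:{a..c}|lborel. q s) = (LINT s:{a..b}|lborel. q s) + (LINT s:{b..c}|lborel. q s)"
proof -
  have "{a..c} = {a..b} \<union> {b..c}" using assms by auto
  moreover have "(LINT s:{a..b} \<union> {b..c}|lborel. q s) =
      (LINT s:{a..b}|lborel. q s) + (LINT s:{b..c}|lborel. q s)"
  proof (rule set_integral_Un_AE)
    show "AE x in lborel. \<not> (x \<in> {a..b} \<and> x \<in> {b..c})"
      using AE_lborel_singleton[of b] by eventually_elim auto
  qed (use assms in \<open>auto intro: set_integrable_Icc_subset[OF assms(1)]\<close>)
  ultimately show ?thesis by simp
qed

text \<open>
A function whose increments over short intervals are those of the integral of \<open>q\<close>, up to an
error that is an arbitrarily small multiple of an additive quantity: summing over a fine partition,
the errors add up to that multiple of one fixed number.  This replaces differentiation almost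
everywhere in the chain rule below.
\<close>

lemma eq_integral_if_local:
  fixes f q m :: "real \<Rightarrow> real"
  assumes "a \<le> b"
    and q: "set_integrable lborel {a..b} q" and m: "set_integrable lborel {a..b} m"
    and loc: "\<And>\<epsilon>. 0 < \<epsilon> \<Longrightarrow> \<exists>\<delta>>0. \<forall>s t. a \<le> s \<longrightarrow> s \<le> t \<longrightarrow> t \<le> b \<longrightarrow> t - s < \<delta> \<longrightarrow>
      \<bar>f t - f s - (LINT r:{s..t}|lborel. q r)\<bar> \<le> \<epsilon> * (LINT r:{s..t}|lborel. m r)"
  shows "f b = f a + (LINT r:{a..b}|lborel. q r)"
proof -
  let ?Q = "\<lambda>s t. LINT r:{s..t}|lborel. q r" and ?M = "\<lambda>s t. LINT r:{s..t}|lborel. m r"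
  have le: "\<bar>f b - f a - ?Q a b\<bar> \<le> \<epsilon> * ?M a b" if "0 < \<epsilon>" for \<epsilon>
  proof -
    obtain \<delta> where \<delta>: "0 < \<delta>" "\<And>s t. \<lbrakk>a \<le> s; s \<le> t; t \<le> b; t - s < \<delta>\<rbrakk> \<Longrightarrow>
      \<bar>f t - f s - ?Q s t\<bar> \<le> \<epsilon> * ?M s t"
      using loc[OF \<open>0 < \<epsilon>\<close>] by blast
    have "a \<le> t \<Longrightarrow> t \<le> b \<Longrightarrow> t - a \<le> real n * (\<delta> / 2) \<Longrightarrow>
        \<bar>f t - f a - ?Q a t\<bar> \<le> \<epsilon> * ?M a t" for n t
    proof (induction n arbitrary: t)
      case 0
      then have "t = a" by simp
      then show ?case by simp
    next
      case (Suc n)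
      define s where "s = max a (t - \<delta> / 2)"
      have s: "a \<le> s" "s - a \<le> real n * (\<delta> / 2)" "s \<le> t" "t - s < \<delta>" "s \<le> b"
        using Suc.prems \<open>0 < \<delta>\<close> by (auto simp: s_def max_def algebra_simps)
      have "?Q a t = ?Q a s + ?Q s t"
        by (rule set_integral_Icc_combine) (use s Suc.prems in \<open>auto intro: set_integrable_subset[OF q]\<close>)
      moreover have "?M a t = ?M a s + ?M s t"
        by (rule set_integral_Icc_combine) (use s Suc.prems in \<open>auto intro: set_integrable_subset[OF m]\<close>)
      moreover have "\<bar>f s - f a - ?Q a s\<bar> \<le> \<epsilon> * ?M a s"
        using s Suc by blast
      moreover have "\<bar>f t - f s - ?Q s t\<bar> \<le> \<epsilon> * ?M s t"
        using s \<delta>(2) Suc.prems by blast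
      ultimately show ?case by (simp add: distrib_left)
    qed
    moreover obtain n where "(b - a) / (\<delta> / 2) \<le> real n"
      using real_arch_simple by blast
    ultimately show ?thesis
      using \<open>a \<le> b\<close> \<delta>(1) by (simp add: field_simps)
  qed
  have "\<bar>f b - f a - ?Q a b\<bar> \<le> 0"
  proof (rule field_le_epsilon)
    fix e :: real assume "0 < e"
    let ?\<epsilon> = "e / (\<bar>?M a b\<bar> + 1)"
    have "\<bar>f b - f a - ?Q a b\<bar> \<le> ?\<epsilon> * ?M a b"
      using \<open>0 < e\<close> by (intro le) (auto simp: add_nonneg_pos)
    also have "\<dots> \<le> ?\<epsilon> * (\<bar>?M a b\<bar> + 1)"
      using \<open>0 < e\<close> by (intro mult_left_mono) auto
    also have "\<dots> = e"
    proof -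
      have "\<bar>?M a b\<bar> + 1 \<noteq> 0" by (rule order.strict_implies_not_eq[symmetric]) (simp add: add_nonneg_pos)
      then show ?thesis by simp
    qed
    finally show "\<bar>f b - f a - ?Q a b\<bar> \<le> 0 + e" by simp
  qed
  then show ?thesis by simp
qed

text \<open>
These are the absolutely continuous functions \<open>y\<close> on \<open>[a,b]\<close> with derivative \<open>q\<close> almost
everywhere; the integral form is the one that the weak formulation provides.
\<close>

definition is_indefinite_integral ::
  "real \<Rightarrow> real \<Rightarrow> (real \<Rightarrow> real) \<Rightarrow> (real \<Rightarrow> real) \<Rightarrow> bool" where
  "is_indefinite_integral a b q y \<longleftrightarrow>
     set_integrable lborel {a..b} q \<and> (\<forall>t\<in>{a..b}. y t = y a + (LINT s:{a..t}|lborel. q s))"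

lemma is_indefinite_integral_integrable:
  "is_indefinite_integral a b q y \<Longrightarrow> set_integrable lborel {a..b} q"
  by (simp add: is_indefinite_integral_def)

lemma is_indefinite_integral_eq:
  "is_indefinite_integral a b q y \<Longrightarrow> a \<le> t \<Longrightarrow> t \<le> b \<Longrightarrow>
    y t = y a + (LINT s:{a..t}|lborel. q s)"
  unfolding is_indefinite_integral_def by (drule conjunct2, erule bspec) simp

lemma is_indefinite_integral_increment:
  assumes y: "is_indefinite_integral a b q y" and "a \<le> s" "s \<le> t" "t \<le> b"
  shows "y t - y s = (LINT r:{s..t}|lborel. q r)"
proof -
  have "set_integrable lborel {a..t} q"
    by (rule set_integrable_Icc_subset[OF is_indefinite_integral_integrable[OF y]])
      (use assms in auto)
  then have "(LINT r:{a..t}|lborel. q r) = (LINT r:{a..s}|lborel. q r) + (LINT r:{s..t}|lborel. q r)"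
    using assms by (intro set_integral_Icc_combine)
  moreover have "y t = y a + (LINT r:{a..t}|lborel. q r)"
    using assms by (intro is_indefinite_integral_eq[OF y]) auto
  moreover have "y s = y a + (LINT r:{a..s}|lborel. q r)"
    using assms by (intro is_indefinite_integral_eq[OF y]) auto
  ultimately show ?thesis by linarith
qed

lemma is_indefinite_integral_subinterval:
  assumes y: "is_indefinite_integral a b q y" and "a \<le> a'" "b' \<le> b"
  shows "is_indefinite_integral a' b' q y"
  unfolding is_indefinite_integral_def
proof (intro conjI ballI)
  show "set_integrable lborel {a'..b'} q"
    by (rule set_integrable_Icc_subset[OF is_indefinite_integral_integrable[OF y] assms(2,3)])
  fix t assume "t \<in> {a'..b'}"
  then have "y t - y a' = (LINT s:{a'..t}|lborel. q s)"
    using assms by (intro is_indefinite_integral_increment[OF y]) auto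
  then show "y t = y a' + (LINT s:{a'..t}|lborel. q s)" by linarith
qed

lemma is_indefinite_integral_diff:
  assumes y: "is_indefinite_integral a b q y" and P: "is_indefinite_integral a b p P"
  shows "is_indefinite_integral a b (\<lambda>s. q s - p s) (\<lambda>s. y s - P s)"
  unfolding is_indefinite_integral_def
proof (intro conjI ballI)
  show "set_integrable lborel {a..b} (\<lambda>s. q s - p s)"
    by (intro set_integral_diff is_indefinite_integral_integrable[OF y]
        is_indefinite_integral_integrable[OF P])
  fix t assume t: "t \<in> {a..b}"
  then have "set_integrable lborel {a..t} q" "set_integrable lborel {a..t} p"
    by (auto intro: set_integrable_Icc_subset[OF is_indefinite_integral_integrable[OF y]]
        set_integrable_Icc_subset[OF is_indefinite_integral_integrable[OF P]])
  then have "(LINT s:{a..t}|lborel. q s - p s) =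
      (LINT s:{a..t}|lborel. q s) - (LINT s:{a..t}|lborel. p s)"
    by (rule set_integral_diff(2))
  moreover have "y t = y a + (LINT s:{a..t}|lborel. q s)"
    using t by (intro is_indefinite_integral_eq[OF y]) auto
  moreover have "P t = P a + (LINT s:{a..t}|lborel. p s)"
    using t by (intro is_indefinite_integral_eq[OF P]) auto
  ultimately show "y t - P t = y a - P a + (LINT s:{a..t}|lborel. q s - p s)" by linarith
qed

lemma is_indefinite_integral_continuous:
  assumes "is_indefinite_integral a b q y"
  shows "continuous_on {a..b} y"
proof -
  have q: "set_integrable lborel {a..b} q"
    by (rule is_indefinite_integral_integrable[OF assms])
  have "continuous_on {a..b} (\<lambda>t. y a + integral {a..t} q)"
    by (intro continuous_intros indefinite_integral_continuous_1 set_borel_integral_eq_integral(1) q)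
  then show ?thesis
  proof (rule continuous_on_eq)
    fix t assume t: "t \<in> {a..b}"
    then have "set_integrable lborel {a..t} q" by (auto intro: set_integrable_subset[OF q])
    from set_borel_integral_eq_integral(2)[OF this] show "y a + integral {a..t} q = y t"
      using t is_indefinite_integral_eq[OF assms, of t] by simp
  qed
qed

lemma set_integrable_continuous_mult:
  fixes c q :: "real \<Rightarrow> real"
  assumes c: "continuous_on {a..b} c" and q: "set_integrable lborel {a..b} q"
  shows "set_integrable lborel {a..b} (\<lambda>s. c s * q s)"
proof -
  have "bounded (c ` {a..b})"
    using compact_continuous_image[OF c compact_Icc] by (rule compact_imp_bounded)
  then obtain C where C: "\<And>s. s \<in> {a..b} \<Longrightarrow> \<bar>c s\<bar> \<le> C"
    unfolding bounded_iff by (auto simp del: atLeastAtMost_iff)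
  have m: "(\<lambda>s. indicator {a..b} s *\<^sub>R c s) \<in> borel_measurable lborel"
    using borel_measurable_continuous_on_indicator[OF _ c] by simp
  have "(\<lambda>s. indicator {a..b} s *\<^sub>R (c s * q s)) =
      (\<lambda>s. (indicator {a..b} s *\<^sub>R c s) * (indicator {a..b} s *\<^sub>R q s))"
    by (auto simp: indicator_def)
  then have m': "set_borel_measurable lborel {a..b} (\<lambda>s. c s * q s)"
    using m q unfolding set_borel_measurable_def set_integrable_def by auto
  have "set_integrable lborel {a..b} (\<lambda>s. C * q s)"
    using q by auto
  then show ?thesis
  proof (rule set_integrable_bound)
    show "AE s in lborel. s \<in> {a..b} \<longrightarrow> norm (c s * q s) \<le> norm (C * q s)"
      using C by (fastforce intro!: AE_I2 mult_right_mono simp: abs_mult)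
  qed (rule m')
qed

text \<open>
On a short interval \<open>[s,t]\<close> the mean value theorem gives
\<open>\<Phi> (y t) - \<Phi> (y s) = \<phi> \<xi> * (y t - y s)\<close> with \<open>\<xi>\<close> between \<open>y s\<close> and \<open>y t\<close>.  By the
intermediate value theorem \<open>\<xi> = y x\<close> for some \<open>x\<close> in \<open>[s,t]\<close>, so the factor differs
from \<open>\<phi> (y r)\<close> by less than \<open>\<epsilon>\<close> for all \<open>r\<close> in \<open>[s,t]\<close>, by uniform continuity of
\<open>\<phi> \<circ> y\<close>.
\<close>

lemma is_indefinite_integral_chain:
  assumes y: "is_indefinite_integral a b q y"
    and der: "\<And>s. s \<in> {a..b} \<Longrightarrow> (\<Phi> has_real_derivative \<phi> (y s)) (at (y s))"
    and cont: "continuous_on (y ` {a..b}) \<phi>"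
  shows "is_indefinite_integral a b (\<lambda>s. \<phi> (y s) * q s) (\<lambda>s. \<Phi> (y s))"
proof -
  have q: "set_integrable lborel {a..b} q"
    by (rule is_indefinite_integral_integrable[OF y])
  have cy: "continuous_on {a..b} y"
    by (rule is_indefinite_integral_continuous[OF y])
  have c: "continuous_on {a..b} (\<lambda>s. \<phi> (y s))"
    using continuous_on_compose[OF cy cont] by (simp add: o_def)
  have \<phi>q: "set_integrable lborel {a..b} (\<lambda>s. \<phi> (y s) * q s)"
    by (rule set_integrable_continuous_mult[OF c q])
  have mv: "\<exists>x\<in>{s..t}. \<Phi> (y t) - \<Phi> (y s) = \<phi> (y x) * (y t - y s)"
    if st: "a \<le> s" "s \<le> t" "t \<le> b" for s t
  proof -
    have cst: "continuous_on {s..t} y"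
      using cy by (rule continuous_on_subset) (use st in auto)
    have conn: "connected (y ` {s..t})" by (intro connected_continuous_image cst) simp
    have up: "\<exists>x\<in>{s..t}. \<Phi> (y j) - \<Phi> (y i) = \<phi> (y x) * (y j - y i)"
      if ij: "i \<in> {s..t}" "j \<in> {s..t}" "y i < y j" for i j
    proof -
      have *: "z \<in> y ` {s..t}" if "y i \<le> z" "z \<le> y j" for z
        using connectedD_interval[OF conn, of "y i" "y j" z] ij that by auto
      have "\<exists>z>y i. z < y j \<and> \<Phi> (y j) - \<Phi> (y i) = (y j - y i) * \<phi> z"
      proof (rule MVT2[OF ij(3)])
        fix z assume "y i \<le> z" "z \<le> y j"
        from *[OF this] show "(\<Phi> has_real_derivative \<phi> z) (at z)"
          using der st by auto
      qed
      then obtain z where z: "y i < z" "z < y j" "\<Phi> (y j) - \<Phi> (y i) = (y j - y i) * \<phi> z" by blast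
      with *[of z] show ?thesis by (auto simp: mult.commute)
    qed
    consider "y s < y t" | "y t < y s" | "y s = y t" by linarith
    then show ?thesis
    proof cases
      case 1 then show ?thesis using up[of s t] st by auto
    next
      case 2
      then obtain x where "x \<in> {s..t}" "\<Phi> (y s) - \<Phi> (y t) = \<phi> (y x) * (y s - y t)"
        using up[of t s] st by auto
      then show ?thesis by (intro bexI[of _ x]) (auto simp: algebra_simps)
    next
      case 3 then show ?thesis using st by (intro bexI[of _ s]) auto
    qed
  qed
  have loc: "\<exists>\<delta>>0. \<forall>s t. a \<le> s \<longrightarrow> s \<le> t \<longrightarrow> t \<le> b \<longrightarrow> t - s < \<delta> \<longrightarrow>
      \<bar>\<Phi> (y t) - \<Phi> (y s) - (LINT r:{s..t}|lborel. \<phi> (y r) * q r)\<bar>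
        \<le> \<epsilon> * (LINT r:{s..t}|lborel. \<bar>q r\<bar>)" if \<epsilon>: "0 < \<epsilon>" for \<epsilon>
  proof -
    have "uniformly_continuous_on {a..b} (\<lambda>s. \<phi> (y s))"
      by (intro compact_uniformly_continuous c) simp
    then obtain \<delta> where \<delta>: "0 < \<delta>" "\<And>x r. \<lbrakk>x \<in> {a..b}; r \<in> {a..b}; \<bar>x - r\<bar> < \<delta>\<rbrakk> \<Longrightarrow>
        \<bar>\<phi> (y x) - \<phi> (y r)\<bar> < \<epsilon>"
      using \<epsilon> unfolding uniformly_continuous_on_def dist_real_def by metis
    have "\<bar>\<Phi> (y t) - \<Phi> (y s) - (LINT r:{s..t}|lborel. \<phi> (y r) * q r)\<bar>
        \<le> \<epsilon> * (LINT r:{s..t}|lborel. \<bar>q r\<bar>)"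
      if st: "a \<le> s" "s \<le> t" "t \<le> b" "t - s < \<delta>" for s t
    proof -
      obtain x where x: "x \<in> {s..t}" "\<Phi> (y t) - \<Phi> (y s) = \<phi> (y x) * (y t - y s)"
        using mv[OF st(1-3)] by blast
      have i: "set_integrable lborel {s..t} q" "set_integrable lborel {s..t} (\<lambda>r. \<phi> (y r) * q r)"
        using st by (auto intro: set_integrable_subset[OF q] set_integrable_subset[OF \<phi>q])
      have i': "set_integrable lborel {s..t} (\<lambda>r. \<phi> (y x) * q r - \<phi> (y r) * q r)"
        by (intro set_integral_diff i set_integrable_mult_right)
      have "\<Phi> (y t) - \<Phi> (y s) - (LINT r:{s..t}|lborel. \<phi> (y r) * q r) =
          (LINT r:{s..t}|lborel. \<phi> (y x) * q r) - (LINT r:{s..t}|lborel. \<phi> (y r) * q r)"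
        using x(2) is_indefinite_integral_increment[OF y st(1-3)] by simp
      also have "\<dots> = (LINT r:{s..t}|lborel. \<phi> (y x) * q r - \<phi> (y r) * q r)"
        by (intro set_integral_diff(2)[symmetric] i set_integrable_mult_right)
      also have "\<bar>\<dots>\<bar> \<le> (LINT r:{s..t}|lborel. \<bar>\<phi> (y x) * q r - \<phi> (y r) * q r\<bar>)"
        using set_integral_norm_bound[OF i'] by simp
      also have "\<dots> \<le> (LINT r:{s..t}|lborel. \<epsilon> * \<bar>q r\<bar>)"
      proof (rule set_integral_mono)
        show "set_integrable lborel {s..t} (\<lambda>r. \<epsilon> * \<bar>q r\<bar>)"
          by (intro set_integrable_mult_right set_integrable_abs i)
        fix r assume "r \<in> {s..t}"
        then have "\<bar>x - r\<bar> < \<delta>" "x \<in> {a..b}" "r \<in> {a..b}"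
          using x(1) st by auto
        then have "\<bar>\<phi> (y x) - \<phi> (y r)\<bar> \<le> \<epsilon>"
          using \<delta>(2) less_imp_le by blast
        then have "\<bar>\<phi> (y x) - \<phi> (y r)\<bar> * \<bar>q r\<bar> \<le> \<epsilon> * \<bar>q r\<bar>"
          by (rule mult_right_mono) simp
        then show "\<bar>\<phi> (y x) * q r - \<phi> (y r) * q r\<bar> \<le> \<epsilon> * \<bar>q r\<bar>"
          by (simp add: abs_mult left_diff_distrib[symmetric])
      qed (intro set_integrable_abs i')
      finally show ?thesis by simp
    qed
    with \<delta>(1) show ?thesis by blast
  qed
  show ?thesis
    unfolding is_indefinite_integral_def
  proof (intro conjI ballI \<phi>q)
    fix t assume t: "t \<in> {a..b}"
    show "\<Phi> (y t) = \<Phi> (y a) + (LINT s:{a..t}|lborel. \<phi> (y s) * q s)"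
    proof (rule eq_integral_if_local[where f = "\<lambda>s. \<Phi> (y s)" and m = "\<lambda>s. \<bar>q s\<bar>"])
      show "set_integrable lborel {a..t} (\<lambda>s. \<phi> (y s) * q s)"
        using t by (auto intro: set_integrable_subset[OF \<phi>q])
      show "set_integrable lborel {a..t} (\<lambda>s. \<bar>q s\<bar>)"
        using t by (auto intro: set_integrable_subset[OF set_integrable_abs[OF q]])
      show "\<exists>\<delta>>0. \<forall>s r. a \<le> s \<longrightarrow> s \<le> r \<longrightarrow> r \<le> t \<longrightarrow> r - s < \<delta> \<longrightarrow>
        \<bar>\<Phi> (y r) - \<Phi> (y s) - (LINT u:{s..r}|lborel. \<phi> (y u) * q u)\<bar>
        \<le> \<epsilon> * (LINT u:{s..r}|lborel. \<bar>q u\<bar>)" if "0 < \<epsilon>" for \<epsilon>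
        using loc[OF that] t by (meson atLeastAtMost_iff order_trans)
    qed (use t in auto)
  qed
qed

text \<open>
The comparison argument.  Formally, \<open>y' \<le> P' y - c e / y\<^sup>2\<close> gives
\<open>(exp (- 3 P) y\<^sup>3)' = 3 exp (- 3 P) y\<^sup>2 (y' - P' y) \<le> - 3 c exp (- 3 P) e\<close>.
Since \<open>exp (- 3 P) y\<^sup>3 = exp (3 (ln y - P))\<close> where \<open>y\<close> is positive, this follows on
\<open>[s,T]\<close>, \<open>s > 0\<close>, from two applications of the chain rule, without a product rule.  The
function \<open>y\<close> may vanish at time 0, which is therefore reached only in the limit \<open>s \<rightarrow> 0\<close>.
\<close>

lemma cube_decay:
  fixes y q P p e :: "real \<Rightarrow> real"
  assumes "0 < T" 
    and y: "is_indefinite_integral 0 T q y" and P: "is_indefinite_integral 0 T p P"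
    and P0: "P 0 = 0"
    and pos: "\<And>t. 0 < t \<Longrightarrow> t \<le> T \<Longrightarrow> 0 < y t"
    and e: "continuous_on {0..T} e"
    and ineq: "AE s in lborel. 0 < s \<and> s < T \<longrightarrow> q s \<le> p s * y s - c * e s / (y s)\<^sup>2"
  shows "exp (- 3 * P T) * y T ^ 3 \<le> y 0 ^ 3 - 3 * c * (LINT s:{0..T}|lborel. exp (- 3 * P s) * e s)"
proof -
  define E where "E = (\<lambda>s. exp (- 3 * P s) * e s)"
  define G where "G = (\<lambda>s. exp (- 3 * P s) * y s ^ 3 + 3 * c * (LINT r:{0..s}|lborel. E r))"
  have cy: "continuous_on {0..T} y" and cP: "continuous_on {0..T} P"
    using y P by (auto intro: is_indefinite_integral_continuous)
  have cE: "continuous_on {0..T} E"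
    unfolding E_def by (intro continuous_intros cP e)
  have iE: "set_integrable lborel {0..T} E"
    by (rule borel_integrable_atLeastAtMost'[OF cE])
  have IE: "is_indefinite_integral 0 T E (\<lambda>s. LINT r:{0..s}|lborel. E r)"
    unfolding is_indefinite_integral_def using iE
    by simp
  have cG: "continuous_on {0..T} G"
    unfolding G_def
    by (intro continuous_intros cP cy is_indefinite_integral_continuous[OF IE])
  \<comment> \<open>\<open>G\<close> is continuous on the closed interval, so it suffices to compare with positive times.\<close>
  have dec: "G T \<le> G s" if s: "0 < s" "s \<le> T" for s
  proof -
    have posT: "0 < y r" if "r \<in> {s..T}" for r
      using pos that s by auto
    have "is_indefinite_integral s T (\<lambda>r. inverse (y r) * q r) (\<lambda>r. ln (y r))"
    proof (rule is_indefinite_integral_chain)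
      show "is_indefinite_integral s T q y"
        using y s by (auto intro: is_indefinite_integral_subinterval)
      show "(ln has_real_derivative inverse (y r)) (at (y r))" if "r \<in> {s..T}" for r
        using posT[OF that] by (rule DERIV_ln)
      show "continuous_on (y ` {s..T}) inverse"
        using posT by (intro continuous_on_inverse continuous_on_id) force
    qed
    then have "is_indefinite_integral s T (\<lambda>r. inverse (y r) * q r - p r) (\<lambda>r. ln (y r) - P r)"
      by (rule is_indefinite_integral_diff) (rule is_indefinite_integral_subinterval[OF P], use s in auto)
    then have I: "is_indefinite_integral s T
        (\<lambda>r. 3 * exp (3 * (ln (y r) - P r)) * (inverse (y r) * q r - p r))
        (\<lambda>r. exp (3 * (ln (y r) - P r)))"
      by (rule is_indefinite_integral_chain[where \<Phi> = "\<lambda>x. exp (3 * x)" and \<phi> = "\<lambda>x. 3 * exp (3 * x)"])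
        (auto intro!: derivative_eq_intros continuous_intros)
    have cube: "exp (3 * (ln (y r) - P r)) = exp (- 3 * P r) * y r ^ 3" if "r \<in> {s..T}" for r
    proof -
      have "exp (3 * (ln (y r) - P r)) = exp (- 3 * P r) * exp (of_nat 3 * ln (y r))"
        by (simp add: exp_add[symmetric] algebra_simps)
      also have "exp (of_nat 3 * ln (y r)) = y r ^ 3"
        by (subst exp_of_nat_mult) (use posT[OF that] in simp)
      finally show ?thesis .
    qed
    have iEs: "set_integrable lborel {s..T} E"
      using s by (auto intro: set_integrable_subset[OF iE])
    have "exp (- 3 * P T) * y T ^ 3 - exp (- 3 * P s) * y s ^ 3 =
        (LINT r:{s..T}|lborel. 3 * exp (3 * (ln (y r) - P r)) * (inverse (y r) * q r - p r))"
      using is_indefinite_integral_increment[OF I, of s T] s cube by simp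
    also have "\<dots> \<le> (LINT r:{s..T}|lborel. (- 3 * c) * E r)"
    proof (rule set_integral_mono_AE)
      show "set_integrable lborel {s..T}
          (\<lambda>r. 3 * exp (3 * (ln (y r) - P r)) * (inverse (y r) * q r - p r))"
        by (rule is_indefinite_integral_integrable[OF I])
      show "set_integrable lborel {s..T} (\<lambda>r. (- 3 * c) * E r)"
        by (intro set_integrable_mult_right iEs)
      show "AE r\<in>{s..T} in lborel.
          3 * exp (3 * (ln (y r) - P r)) * (inverse (y r) * q r - p r) \<le> (- 3 * c) * E r"
        using ineq AE_lborel_singleton[of T]
      proof eventually_elim
        case (elim r)
        show ?case
        proof
          assume r: "r \<in> {s..T}"
          have yr: "0 < y r" using posT[OF r] .
          have "q r \<le> p r * y r - c * e r / (y r)\<^sup>2" using elim r s by auto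
          then have "inverse (y r) * q r \<le> inverse (y r) * (p r * y r - c * e r / (y r)\<^sup>2)"
            using yr by (intro mult_left_mono) auto
          also have "\<dots> = p r - c * e r / y r ^ 3"
            using yr by (simp add: field_simps power2_eq_square power3_eq_cube)
          finally have *: "inverse (y r) * q r - p r \<le> - (c * e r / y r ^ 3)" by simp
          have "3 * exp (3 * (ln (y r) - P r)) * (inverse (y r) * q r - p r)
              \<le> 3 * exp (3 * (ln (y r) - P r)) * (- (c * e r / y r ^ 3))"
            by (intro mult_left_mono *) simp
          also have "\<dots> = (- 3 * c) * E r"
            unfolding cube[OF r] E_def using yr by simp
          finally show "3 * exp (3 * (ln (y r) - P r)) * (inverse (y r) * q r - p r)
              \<le> (- 3 * c) * E r" .
        qed
      qed
    qed
    also have "\<dots> = - 3 * c * (LINT r:{s..T}|lborel. E r)"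
      by (rule set_integral_mult_right)
    also have "(LINT r:{s..T}|lborel. E r) = (LINT r:{0..T}|lborel. E r) - (LINT r:{0..s}|lborel. E r)"
      using is_indefinite_integral_increment[OF IE, of s T] s by simp
    finally show ?thesis
      unfolding G_def by (simp add: algebra_simps)
  qed
  have "G T \<le> G 0"
  proof (rule tendsto_lowerbound)
    show "(G \<longlongrightarrow> G 0) (at 0 within {0..T})"
      using cG \<open>0 < T\<close> unfolding continuous_on_def by auto
    show "\<forall>\<^sub>F s in at 0 within {0..T}. G T \<le> G s"
      using dec by (auto simp: eventually_at_filter)
    show "at 0 within {0..T} \<noteq> bot"
      using \<open>0 < T\<close> by (simp add: at_within_Icc_at_right trivial_limit_at_right_real)
  qed
  moreover have "(LINT r:{0..0}|lborel. E r) = 0"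
    by simp
  ultimately show ?thesis
    unfolding G_def E_def using P0 by (simp add: algebra_simps)
qed

section \<open>Projection of the singular reaction on the first eigenfunction\<close>

lemma L2_on_mult_integrable:
  assumes "L2_on D u" "L2_on D w"
  shows "set_integrable lborel D (\<lambda>x. u x * w x)"
proof -
  have "set_integrable lborel D (\<lambda>x. (u x)\<^sup>2 + (w x)\<^sup>2)"
    using assms by (intro set_integral_add) (auto simp: L2_on_def)
  then show ?thesis
  proof (rule set_integrable_bound)
    have "(\<lambda>x. indicator D x *\<^sub>R (u x * w x)) =
        (\<lambda>x. (indicator D x *\<^sub>R u x) * (indicator D x *\<^sub>R w x))"
      by (auto simp: indicator_def)
    then show "set_borel_measurable lborel D (\<lambda>x. u x * w x)"
      using assms unfolding L2_on_def set_borel_measurable_def by auto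
    have "\<bar>u x * w x\<bar> \<le> (u x)\<^sup>2 + (w x)\<^sup>2" for x
    proof -
      have "2 * (\<bar>u x\<bar> * \<bar>w x\<bar>) \<le> (u x)\<^sup>2 + (w x)\<^sup>2"
        using zero_le_power2[of "\<bar>u x\<bar> - \<bar>w x\<bar>"] by (simp add: power2_diff)
      moreover have "0 \<le> \<bar>u x\<bar> * \<bar>w x\<bar>" by simp
      ultimately show ?thesis unfolding abs_mult by linarith
    qed
    then show "AE x in lborel. x \<in> D \<longrightarrow> norm (u x * w x) \<le> norm ((u x)\<^sup>2 + (w x)\<^sup>2)"
      by (intro AE_I2) (simp add: abs_of_nonneg)
  qed
qed

lemma inner_on_pos:
  assumes "set_integrable lborel D (\<lambda>x. w x * \<psi> x)"
    and "\<And>x. x \<in> D \<Longrightarrow> 0 < w x" "\<And>x. x \<in> D \<Longrightarrow> 0 < \<psi> x"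
    and "(LINT x:D|lborel. \<psi> x) \<noteq> 0"
  shows "0 < inner_on D w \<psi>"
proof (rule ccontr)
  assume "\<not> 0 < inner_on D w \<psi>"
  moreover have nn: "0 \<le> indicator D x *\<^sub>R (w x * \<psi> x)" for x
    using assms(2,3)[of x] by (auto simp: indicator_def)
  moreover have "0 \<le> inner_on D w \<psi>"
    unfolding inner_on_def set_lebesgue_integral_def by (intro integral_nonneg_AE AE_I2 nn)
  ultimately have "(LINT x|lborel. indicator D x *\<^sub>R (w x * \<psi> x)) = 0"
    unfolding inner_on_def set_lebesgue_integral_def by linarith
  then have "AE x in lborel. indicator D x *\<^sub>R (w x * \<psi> x) = 0"
    using integral_nonneg_eq_0_iff_AE[of lborel "\<lambda>x. indicator D x *\<^sub>R (w x * \<psi> x)"] assms(1) nn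
    unfolding set_integrable_def by auto
  then have "AE x in lborel. indicator D x *\<^sub>R \<psi> x = 0"
  proof eventually_elim
    case (elim x)
    then show ?case using assms(2)[of x] by (auto simp: indicator_def split: if_splits)
  qed
  then have "(LINT x:D|lborel. \<psi> x) = 0"
    unfolding set_lebesgue_integral_def by (rule integral_eq_zero_AE)
  with assms(4) show False by simp
qed

text \<open>
The convex function \<open>w \<mapsto> w powi (- 2)\<close> lies above its tangent at \<open>Y\<close>; the difference,
multiplied by \<open>Y ^ 3 * w\<^sup>2\<close>, is \<open>(Y - w)\<^sup>2 * (Y + 2 * w)\<close>.
\<close>

lemma inverse_square_tangent:
  fixes w Y :: real
  assumes "0 < w" "0 < Y"
  shows "3 / Y\<^sup>2 - 2 * w / Y ^ 3 \<le> w powi (- 2)"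
proof -
  have "0 \<le> (Y - w)\<^sup>2 * (Y + 2 * w)"
    using assms by (intro mult_nonneg_nonneg) auto
  also have "\<dots> = Y ^ 3 - 3 * Y * w\<^sup>2 + 2 * w ^ 3"
    by (simp add: power2_eq_square power3_eq_cube algebra_simps)
  finally have "3 * Y * w\<^sup>2 - 2 * w ^ 3 \<le> Y ^ 3" by simp
  then have "(3 * Y * w\<^sup>2 - 2 * w ^ 3) / (Y ^ 3 * w\<^sup>2) \<le> Y ^ 3 / (Y ^ 3 * w\<^sup>2)"
    using assms by (intro divide_right_mono) auto
  moreover have "(3 * Y * w\<^sup>2 - 2 * w ^ 3) / (Y ^ 3 * w\<^sup>2) = 3 / Y\<^sup>2 - 2 * w / Y ^ 3"
    using assms by (simp add: field_simps power2_eq_square power3_eq_cube)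
  moreover have "Y ^ 3 / (Y ^ 3 * w\<^sup>2) = w powi (- 2)"
    using assms by (simp add: power_int_minus field_simps)
  ultimately show ?thesis by simp
qed

text \<open>
Jensen's inequality for the probability density \<open>\<psi>\<close> and the convex function
\<open>u \<mapsto> u powi (- 2)\<close>, in the form of its proof: the tangent at the mean \<open>Y\<close> is integrated
against \<open>\<psi>\<close>, and its first-order term integrates to zero, which leaves \<open>1 / Y\<^sup>2\<close>.  The
function that is compared with \<open>g x (w x) * \<psi> x\<close> is then affine in \<open>w x\<close>, hence integrable
against \<open>\<psi>\<close>.
\<close>

lemma singular_reaction_projection:
  fixes \<psi> w :: "'x::euclidean_space \<Rightarrow> real"
  assumes g_lower: "\<And>x u. x \<in> D \<Longrightarrow> 0 < u \<Longrightarrow> g x u \<ge> \<eta> * (lam * \<zeta> x * u powi (- 2) - \<gamma> * u)"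
    and const: "0 < \<eta>" "0 < lam"
    and \<zeta>: "0 \<le> \<zeta>m" "\<And>x. x \<in> D \<Longrightarrow> \<zeta>m \<le> \<zeta> x"
    and \<psi>: "set_integrable lborel D \<psi>" "\<And>x. x \<in> D \<Longrightarrow> 0 \<le> \<psi> x" "(LINT x:D|lborel. \<psi> x) = 1"
    and w: "set_integrable lborel D (\<lambda>x. w x * \<psi> x)" "\<And>x. x \<in> D \<Longrightarrow> 0 < w x"
    and Y: "0 < inner_on D w \<psi>"
    and gi: "set_integrable lborel D (\<lambda>x. g x (w x) * \<psi> x)"
  shows "\<eta> * (lam * \<zeta>m / (inner_on D w \<psi>)\<^sup>2 - \<gamma> * inner_on D w \<psi>) \<le> inner_on D (\<lambda>x. g x (w x)) \<psi>"
proof -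
  define Y where "Y = inner_on D w \<psi>"
  have "0 < Y" using Y by (simp add: Y_def)
  \<comment> \<open>After the tangent bound, the lower bound of \<open>g x (w x)\<close> is \<open>?A - ?B * w x\<close>.\<close>
  let ?A = "\<eta> * lam * \<zeta>m * (3 / Y\<^sup>2)" and ?B = "\<eta> * (lam * \<zeta>m * (2 / Y ^ 3) + \<gamma>)"
  have iA: "set_integrable lborel D (\<lambda>x. ?A * \<psi> x)" and iB: "set_integrable lborel D (\<lambda>x. ?B * (w x * \<psi> x))"
    by (intro set_integrable_mult_right \<psi>(1) w(1))+
  have "\<eta> * (lam * \<zeta>m / Y\<^sup>2 - \<gamma> * Y) = ?A * 1 - ?B * Y"
    using \<open>0 < Y\<close> by (simp add: field_simps power2_eq_square power3_eq_cube)
  also have "\<dots> = (LINT x:D|lborel. ?A * \<psi> x) - (LINT x:D|lborel. ?B * (w x * \<psi> x))"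
    by (simp only: set_integral_mult_right \<psi>(3) Y_def inner_on_def)
  also have "\<dots> = (LINT x:D|lborel. ?A * \<psi> x - ?B * (w x * \<psi> x))"
    by (rule set_integral_diff(2)[OF iA iB, symmetric])
  also have "\<dots> \<le> (LINT x:D|lborel. g x (w x) * \<psi> x)"
  proof (rule set_integral_mono)
    show "set_integrable lborel D (\<lambda>x. ?A * \<psi> x - ?B * (w x * \<psi> x))"
      by (rule set_integral_diff(1)[OF iA iB])
    fix x assume x: "x \<in> D"
    have "lam * \<zeta>m * (3 / Y\<^sup>2 - 2 * w x / Y ^ 3) \<le> lam * \<zeta>m * (w x powi (- 2))"
      using const \<zeta> w(2)[OF x] \<open>0 < Y\<close> by (intro mult_left_mono inverse_square_tangent) auto
    also have "\<dots> \<le> lam * \<zeta> x * (w x powi (- 2))"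
      using const \<zeta>(2)[OF x] w(2)[OF x] by (intro mult_right_mono mult_left_mono) auto
    finally have "\<eta> * (lam * \<zeta>m * (3 / Y\<^sup>2 - 2 * w x / Y ^ 3) - \<gamma> * w x)
        \<le> \<eta> * (lam * \<zeta> x * (w x powi (- 2)) - \<gamma> * w x)"
      using const by (intro mult_left_mono) auto
    also have "\<dots> \<le> g x (w x)" using g_lower[OF x w(2)[OF x]] .
    finally have "\<eta> * (lam * \<zeta>m * (3 / Y\<^sup>2 - 2 * w x / Y ^ 3) - \<gamma> * w x) * \<psi> x \<le> g x (w x) * \<psi> x"
      using \<psi>(2)[OF x] by (intro mult_right_mono)
    then show "?A * \<psi> x - ?B * (w x * \<psi> x) \<le> g x (w x) * \<psi> x"
      by (simp add: algebra_simps)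
  qed (rule gi)
  finally show ?thesis by (simp add: Y_def inner_on_def)
qed

lemma half_sq_integral_indefinite:
  assumes "\<forall>t\<ge>0. set_integrable lborel {0..t} (\<lambda>s. (f s)\<^sup>2)"
  shows "is_indefinite_integral 0 T (\<lambda>s. (1/2) * (f s)\<^sup>2) (half_sq_integral f)"
proof (cases "0 \<le> T")
  case True
  have "set_integrable lborel {0..T} (\<lambda>s. (1/2) * (f s)\<^sup>2)"
    by (intro set_integrable_mult_right) (use assms True in blast)
  then show ?thesis
    unfolding is_indefinite_integral_def half_sq_integral_def by simp
next
  case False
  then show ?thesis by (simp add: is_indefinite_integral_def)
qed

text \<open>
Testing the weak formulation with the first eigenfunction turns the nonlocal operator into
multiplication by \<open>\<mu>1\<close> and leaves a scalar inequality for \<open>y t = inner_on D (v t) \<psi>1\<close>.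
The conclusion is strict because \<open>y\<close> is still positive at every time before \<open>\<tau>\<close>; strictness
matters, since the stopping time is reached as soon as the integral equals its threshold.
\<close>

lemma projected_solution_decay:
  fixes D :: "'x::euclidean_space set" and n :: "real \<Rightarrow> real"
  assumes eigen: "first_eigenpair \<nu> D \<beta> \<mu>1 \<psi>1"
    and coeff_int: "\<forall>t\<ge>0. set_integrable lborel {0..t} (\<lambda>s. (k s)\<^sup>2)"
      "\<forall>t\<ge>0. set_integrable lborel {0..t} (\<lambda>s. (a s)\<^sup>2)"
    and n: "continuous_on {0..} n"
    and const: "0 < lam" "0 < \<eta>1"
    and \<zeta>: "0 \<le> \<zeta>m" "\<forall>x\<in>D. \<zeta>m \<le> \<zeta> x"
    and g_lower: "\<forall>x\<in>D. \<forall>u>0. g x u \<ge> \<eta>1 * (lam * \<zeta> x * u powi (- 2) - \<gamma> * u)"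
    and sol: "weak_solution_R \<nu> D \<beta> g k a n z0 \<tau> v"
    and pos: "positive_until D \<tau> v"
    and T: "0 < T" "ereal T < \<tau>"
  shows "3 * lam * \<eta>1 * \<zeta>m * (LINT s:{0..T}|lborel.
      exp (- 3 * (\<eta>1 * \<gamma> * s - \<mu>1 * half_sq_integral k s - half_sq_integral a s) + 3 * n s))
    < inner_on D z0 \<psi>1 ^ 3"
proof -
  define y where "y = (\<lambda>t. inner_on D (v t) \<psi>1)"
  define q where "q = rhs_R D g k a n v \<psi>1 (\<lambda>x. \<mu>1 * \<psi>1 x)"
  \<comment> \<open>\<open>P\<close> is the exponential growth rate, integrated in time, that the linear terms of the
    inequality for \<open>y\<close> allow; \<open>p\<close> is its density.\<close>
  define P where "P = (\<lambda>t. \<eta>1 * \<gamma> * t - \<mu>1 * half_sq_integral k t - half_sq_integral a t)"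
  define p where "p = (\<lambda>t. \<eta>1 * \<gamma> - \<mu>1 * ((1/2) * (k t)\<^sup>2) - (1/2) * (a t)\<^sup>2)"
  define c where "c = lam * \<eta>1 * \<zeta>m"
  have rr: "robin_realization \<nu> D \<beta> \<psi>1 (\<lambda>x. \<mu>1 * \<psi>1 x)"
    and \<psi>1: "set_integrable lborel D \<psi>1" "\<And>x. x \<in> D \<Longrightarrow> 0 < \<psi>1 x" "(LINT x:D|lborel. \<psi>1 x) = 1"
    using eigen unfolding first_eigenpair_def eigenpair_def by auto
  have L2: "L2_on D \<psi>1"
    using rr unfolding robin_realization_def form_domain_def by blast
  have below: "ereal t < \<tau>" if "t \<le> T" for t
    using that T(2) by (meson ereal_less_eq(3) order.strict_trans1)
  have vpos: "0 < v t x" if "0 < t" "t \<le> T" "x \<in> D" for t x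
    using pos below that unfolding positive_until_def by blast
  have vint: "set_integrable lborel D (\<lambda>x. v t x * \<psi>1 x)" if "0 < t" "t \<le> T" for t
    using sol below[OF that(2)] that unfolding weak_solution_R_def
    by (intro L2_on_mult_integrable L2) auto
  have ypos: "0 < y t" if "0 < t" "t \<le> T" for t
    using inner_on_pos[OF vint[OF that], OF vpos[OF that] \<psi>1(2)] \<psi>1(3) that by (simp add: y_def)
  have weak: "\<And>t. 0 \<le> t \<Longrightarrow> t \<le> T \<Longrightarrow>
        (AE s in lborel. 0 < s \<and> s < t \<longrightarrow>
           set_integrable lborel D (\<lambda>x. g x (exp (- n s) * v s x) * \<psi>1 x)) \<and>
        set_integrable lborel {0..t} q \<and>
        inner_on D (v t) \<psi>1 = inner_on D z0 \<psi>1 + (LINT s:{0..t}|lborel. q s)"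
    using sol rr below unfolding weak_solution_R_def q_def by blast
  have y0: "y 0 = inner_on D z0 \<psi>1"
    using weak[of 0] T by (simp add: y_def)
  have y: "is_indefinite_integral 0 T q y"
    unfolding is_indefinite_integral_def
  proof (intro conjI ballI)
    show "set_integrable lborel {0..T} q" using weak[of T] T by simp
    show "y t = y 0 + (LINT s:{0..t}|lborel. q s)" if "t \<in> {0..T}" for t
      using weak[of t] y0 that by (simp add: y_def)
  qed
  have P: "is_indefinite_integral 0 T p P"
  proof -
    have id: "is_indefinite_integral 0 T (\<lambda>_. \<eta>1 * \<gamma>) (\<lambda>t. \<eta>1 * \<gamma> * t)"
      unfolding is_indefinite_integral_def using T
      by (auto simp: set_integrable_def set_lebesgue_integral_def)
    have K: "is_indefinite_integral 0 T (\<lambda>t. \<mu>1 * ((1/2) * (k t)\<^sup>2)) (\<lambda>t. \<mu>1 * half_sq_integral k t)"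
      by (rule is_indefinite_integral_chain[OF half_sq_integral_indefinite[OF coeff_int(1)],
            where \<Phi> = "\<lambda>x. \<mu>1 * x" and \<phi> = "\<lambda>_. \<mu>1"])
        (auto intro!: derivative_eq_intros)
    show ?thesis
      unfolding p_def P_def
      by (intro is_indefinite_integral_diff id K half_sq_integral_indefinite coeff_int(2))
  qed
  have ineq: "AE s in lborel. 0 < s \<and> s < T \<longrightarrow> q s \<le> p s * y s - c * exp (3 * n s) / (y s)\<^sup>2"
  proof -
    have "AE s in lborel. 0 < s \<and> s < T \<longrightarrow>
           set_integrable lborel D (\<lambda>x. g x (exp (- n s) * v s x) * \<psi>1 x)"
      using weak[of T] T by simp
    then show ?thesis
    proof eventually_elim
      case (elim s)
      show ?case
      proof
        assume s: "0 < s \<and> s < T"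
        let ?w = "\<lambda>x. exp (- n s) * v s x" and ?G = "inner_on D (\<lambda>x. g x (exp (- n s) * v s x)) \<psi>1"
        have ys: "y s = inner_on D (v s) \<psi>1" "0 < y s"
          using s ypos by (auto simp: y_def)
        have w: "inner_on D ?w \<psi>1 = exp (- n s) * y s"
          unfolding ys(1) inner_on_def by (simp add: mult.assoc)
        have "\<eta>1 * (lam * \<zeta>m / (inner_on D ?w \<psi>1)\<^sup>2 - \<gamma> * inner_on D ?w \<psi>1) \<le> ?G"
        proof (rule singular_reaction_projection)
          show "set_integrable lborel D (\<lambda>x. ?w x * \<psi>1 x)"
            using vint[of s] s by (simp add: mult.assoc)
          show "0 < inner_on D ?w \<psi>1" unfolding w using ys by simp
          show "set_integrable lborel D (\<lambda>x. g x (?w x) * \<psi>1 x)" using elim s by blast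
          show "0 < ?w x" if "x \<in> D" for x using vpos[of s x] s that by simp
          show "0 \<le> \<psi>1 x" if "x \<in> D" for x using \<psi>1(2)[OF that] by simp
        qed (use g_lower const \<zeta> \<psi>1 in auto)
        then have "exp (n s) * (\<eta>1 * (lam * \<zeta>m / (exp (- n s) * y s)\<^sup>2 - \<gamma> * (exp (- n s) * y s)))
            \<le> exp (n s) * ?G"
          unfolding w by (rule mult_left_mono) simp
        \<comment> \<open>The powers of \<open>exp (n s)\<close>: one in front of the reaction and two from the inverse
          square give \<open>exp (3 * n s)\<close>, while they cancel in the linear term.\<close>
        moreover have "exp (n s) * (\<eta>1 * (lam * \<zeta>m / (exp (- n s) * y s)\<^sup>2 - \<gamma> * (exp (- n s) * y s)))
            = c * exp (3 * n s) / (y s)\<^sup>2 - \<eta>1 * \<gamma> * y s"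
        proof -
          have e: "exp (- n s) = inverse (exp (n s))" "exp (3 * n s) = exp (n s) ^ 3"
            by (simp_all add: exp_minus exp_of_nat_mult[of 3, simplified])
          show ?thesis
            unfolding e c_def using ys(2)
            by (simp add: field_simps power2_eq_square power3_eq_cube)
        qed
        moreover have "q s = - (1/2) * (k s)\<^sup>2 * (\<mu>1 * y s) - (1/2) * (a s)\<^sup>2 * y s - exp (n s) * ?G"
        proof -
          have "inner_on D (v s) (\<lambda>x. \<mu>1 * \<psi>1 x) = \<mu>1 * y s"
            unfolding ys(1) inner_on_def by (simp add: mult.left_commute)
          then show ?thesis unfolding q_def rhs_R_def ys(1) by simp
        qed
        moreover have "- (1/2) * (k s)\<^sup>2 * (\<mu>1 * y s) - (1/2) * (a s)\<^sup>2 * y s + \<eta>1 * \<gamma> * y s = p s * y s"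
          unfolding p_def by (simp add: algebra_simps)
        ultimately show "q s \<le> p s * y s - c * exp (3 * n s) / (y s)\<^sup>2" by linarith
      qed
    qed
  qed
  have "exp (- 3 * P T) * y T ^ 3 \<le>
      y 0 ^ 3 - 3 * c * (LINT s:{0..T}|lborel. exp (- 3 * P s) * exp (3 * n s))"
  proof (rule cube_decay[OF T(1) y P _ ypos _ ineq])
    show "P 0 = 0" by (simp add: P_def half_sq_integral_def)
    have "continuous_on {0..T} n" using n by (rule continuous_on_subset) auto
    then show "continuous_on {0..T} (\<lambda>s. exp (3 * n s))" by (intro continuous_intros)
  qed
  moreover have "0 < exp (- 3 * P T) * y T ^ 3"
    using ypos T by simp
  ultimately have "3 * c * (LINT s:{0..T}|lborel. exp (- 3 * P s) * exp (3 * n s)) < y 0 ^ 3"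
    by linarith
  then show ?thesis
    unfolding P_def c_def y0 by (simp add: exp_add mult.assoc)
qed

lemma tau_star_ge:
  assumes "0 < lam * \<eta>1 * \<zeta>m"
    and "\<And>t. 0 < t \<Longrightarrow> ereal t < \<tau> \<Longrightarrow> 3 * lam * \<eta>1 * \<zeta>m * (LINT s:{0..t}|lborel.
      exp (- 3 * (\<eta>1 * \<gamma> * s - \<mu>1 * half_sq_integral k s - half_sq_integral a s) + 3 * n s)) < y0 ^ 3"
  shows "\<tau> \<le> tau_star \<eta>1 \<gamma> lam \<zeta>m \<mu>1 k a y0 n"
  unfolding tau_star_def
proof (rule Inf_greatest, clarify)
  fix t :: real
  let ?I = "LINT s:{0..t}|lborel.
      exp (- 3 * (\<eta>1 * \<gamma> * s - \<mu>1 * half_sq_integral k s - half_sq_integral a s) + 3 * n s)"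
  assume t: "0 < t" "y0 ^ 3 / (3 * lam * \<eta>1 * \<zeta>m) \<le> ?I"
  have "0 < 3 * lam * \<eta>1 * \<zeta>m" using assms(1) by (simp add: mult.assoc)
  then have "y0 ^ 3 \<le> 3 * lam * \<eta>1 * \<zeta>m * ?I"
    using t(2) by (simp add: pos_divide_le_eq mult.commute)
  then show "\<tau> \<le> ereal t"
    using assms(2)[OF t(1)] by (meson not_le)
qed

section \<open>Noise paths and quenching\<close>

text \<open>
Passing between the two formulations multiplies the solution by a positive function of time, which
factors out of the infimum over space and has a finite limit at the quenching time.
\<close>

lemma quenches_at_scale:
  assumes c: "(c \<longlongrightarrow> l) (at_left T)" "\<And>t. 0 < c t" and "D \<noteq> {}"
    and u: "quenches_at D u T"
  shows "quenches_at D (\<lambda>t x. c t * u t x) T"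
proof -
  have INF: "(INF x\<in>D. \<bar>c t * u t x\<bar>) = c t * (INF x\<in>D. \<bar>u t x\<bar>)" for t
  proof -
    have "c t * Inf ((\<lambda>x. \<bar>u t x\<bar>) ` D) = Inf ((*) (c t) ` (\<lambda>x. \<bar>u t x\<bar>) ` D)"
    proof (rule continuous_at_Inf_mono)
      show "mono ((*) (c t))" using c(2)[of t] by (intro monoI mult_left_mono) auto
      show "continuous (at_right (Inf ((\<lambda>x. \<bar>u t x\<bar>) ` D))) ((*) (c t))"
        by (intro continuous_intros)
      show "bdd_below ((\<lambda>x. \<bar>u t x\<bar>) ` D)" by (rule bdd_belowI2[of _ 0]) simp
    qed (use \<open>D \<noteq> {}\<close> in simp)
    then show ?thesis
      using c(2)[of t] by (simp add: image_image abs_mult)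
  qed
  have "((\<lambda>t. c t * (INF x\<in>D. \<bar>u t x\<bar>)) \<longlongrightarrow> l * 0) (at_left T)"
    using u by (intro tendsto_mult c(1)) (simp add: quenches_at_def)
  then show ?thesis unfolding quenches_at_def INF by simp
qed

text \<open>
The Ito part has continuous paths by construction; the pathwise part inherits them from the
fractional Brownian motion.  Continuity is used twice: to move quenching between \<open>v\<close> and \<open>z\<close>,
and to make the integrand in the definition of the stopping time integrable, as otherwise its
integral would have the default value 0.
\<close>

lemma mixed_noise_continuous:
  assumes X: "continuous_paths M X" and N: "mixed_noise M F a b W X N"
  shows "continuous_paths M N"
proof -
  obtain I where I: "continuous_paths M I"
    and RS: "AE \<omega> in M. \<forall>t\<ge>0. has_RS_integral b (\<lambda>s. X s \<omega>) 0 t (N t \<omega> - I t \<omega>)"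
    using N unfolding mixed_noise_def ito_integral_process_def by blast
  show ?thesis
    using X I RS unfolding continuous_paths_def
  proof eventually_elim
    case (elim \<omega>)
    have "continuous_on {0..} (\<lambda>t. N t \<omega> - I t \<omega>)"
      by (rule RS_integral_continuous[OF _ elim(1)]) (use elim(3) in blast)
    from continuous_on_add[OF this elim(2)] show ?case by simp
  qed
qed

theorem theorem1:
  fixes D B :: "'x::euclidean_space set"
    and \<nu> \<beta> \<psi>1 \<zeta> z0 :: "'x \<Rightarrow> real"
    and g :: "'x \<Rightarrow> real \<Rightarrow> real"
    and \<mu>1 lam \<gamma> \<eta>1 \<zeta>m H :: real
    and a b k :: "real \<Rightarrow> real"
    and M :: "'w measure"
    and F :: "real \<Rightarrow> 'w measure"
    and W X N :: "real \<Rightarrow> 'w \<Rightarrow> real"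
    and v z :: "'w \<Rightarrow> real \<Rightarrow> 'x \<Rightarrow> real"
    and \<tau> :: "'w \<Rightarrow> ereal"
  assumes domain: "open D" "compact (frontier D)" "lipschitz_boundary D"
    and levy: "symmetric_levy_density \<nu>"
    and robin: "open B" "bounded B" "robin_coefficient \<nu> D B \<beta>"
    and eigen: "first_eigenpair \<nu> D \<beta> \<mu>1 \<psi>1"
    and filt: "filtered_prob_space M F"
    and bm: "brownian_motion M F W"
    and hurst: "1/2 < H" "H < 1"
    and fbm: "fractional_brownian_motion M F H X"
    and coeff_pos: "\<forall>t\<ge>0. 0 < a t \<and> 0 < b t \<and> 0 < k t"
    and coeff_int: "\<forall>t\<ge>0. set_integrable lborel {0..t} (\<lambda>s. (k s)\<^sup>2)"
      "\<forall>t\<ge>0. set_integrable lborel {0..t} (\<lambda>s. (a s)\<^sup>2)"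
    and noise: "mixed_noise M F a b W X N"
    and const_pos: "0 < lam" "0 < \<gamma>" "0 < \<eta>1"
    and zeta: "\<forall>x\<in>closure D. 0 < \<zeta> x"
      "\<zeta>m \<in> \<zeta> ` closure D" "\<forall>x\<in>closure D. \<zeta>m \<le> \<zeta> x"
    and g_sing: "\<forall>x\<in>D. filterlim (g x) at_top (at_right 0)"
    and g_neg: "\<forall>x\<in>D. \<forall>\<^sub>F u in at_top. g x u < 0"
    and g_lower: "\<forall>x\<in>D. \<forall>u>0. g x u \<ge> \<eta>1 * (lam * \<zeta> x * u powi (- 2) - \<gamma> * u)"
    and init: "L2_on D z0" "\<forall>x\<in>D. 0 \<le> z0 x \<and> z0 x < 1"
    and quench: "quenching_time M F D v \<tau>"
    and sol: "AE \<omega> in M. weak_solution_R \<nu> D \<beta> g k a (\<lambda>t. N t \<omega>) z0 (\<tau> \<omega>) (v \<omega>)"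
    and pos: "AE \<omega> in M. positive_until D (\<tau> \<omega>) (v \<omega>)"
    and z_def: "\<forall>\<omega> t x. z \<omega> t x = exp (- N t \<omega>) * v \<omega> t x"
  shows "(AE \<omega> in M. weak_solution_S \<nu> D \<beta> g k a (\<lambda>t. N t \<omega>) z0 (\<tau> \<omega>) (z \<omega>)) \<and>
    quenching_time M F D z \<tau> \<and>
    (AE \<omega> in M.
       tau_star \<eta>1 \<gamma> lam \<zeta>m \<mu>1 k a (inner_on D z0 \<psi>1) (\<lambda>t. N t \<omega>) < \<infinity> \<longrightarrow>
       \<tau> \<omega> < \<infinity> \<and>
       quenches_at D (v \<omega>) (real_of_ereal (\<tau> \<omega>)) \<and>
       quenches_at D (z \<omega>) (real_of_ereal (\<tau> \<omega>)) \<and>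
       \<tau> \<omega> \<le> tau_star \<eta>1 \<gamma> lam \<zeta>m \<mu>1 k a (inner_on D z0 \<psi>1) (\<lambda>t. N t \<omega>))"
proof -
  have "\<zeta>m > 0" using zeta by auto
  have "D \<noteq> {}" using eigen unfolding first_eigenpair_def set_lebesgue_integral_def by auto
  have z_eq: "z \<omega> = (\<lambda>t x. exp (- N t \<omega>) * v \<omega> t x)" for \<omega>
    using z_def by (simp add: fun_eq_iff)
  have contN: "AE \<omega> in M. continuous_on {0..} (\<lambda>t. N t \<omega>)"
    using mixed_noise_continuous[OF _ noise] fbm
    unfolding fractional_brownian_motion_def continuous_paths_def by blast
  have "AE \<omega> in M. weak_solution_S \<nu> D \<beta> g k a (\<lambda>t. N t \<omega>) z0 (\<tau> \<omega>) (z \<omega>)"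
    using sol
  proof eventually_elim
    case (elim \<omega>)
    have "(\<lambda>t x. exp (N t \<omega>) * z \<omega> t x) = v \<omega>"
      unfolding z_eq by (simp add: mult.assoc[symmetric] exp_add[symmetric])
    with elim show ?case unfolding weak_solution_S_def by simp
  qed
  moreover have qz: "quenching_time M F D z \<tau>"
  proof -
    have "AE \<omega> in M. \<tau> \<omega> < \<infinity> \<longrightarrow> quenches_at D (v \<omega>) (real_of_ereal (\<tau> \<omega>))"
      using quench by (simp add: quenching_time_def)
    then have "AE \<omega> in M. \<tau> \<omega> < \<infinity> \<longrightarrow> quenches_at D (z \<omega>) (real_of_ereal (\<tau> \<omega>))"
      using contN AE_space
    proof eventually_elim
      case (elim \<omega>)
      show ?case
      proof
        assume "\<tau> \<omega> < \<infinity>"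
        have "0 < \<tau> \<omega>" using quench elim(3) by (simp add: quenching_time_def)
        then obtain T where T: "\<tau> \<omega> = ereal T" "0 < T"
          using \<open>\<tau> \<omega> < \<infinity>\<close> by (cases "\<tau> \<omega>") auto
        have "continuous_on {0<..} (\<lambda>t. N t \<omega>)"
          using elim(2) by (rule continuous_on_subset) auto
        then have "isCont (\<lambda>t. N t \<omega>) T"
          using T by (simp add: continuous_on_eq_continuous_at)
        then have "((\<lambda>t. N t \<omega>) \<longlongrightarrow> N T \<omega>) (at_left T)"
          unfolding isCont_def by (rule tendsto_within_subset) simp
        then have "((\<lambda>t. exp (- N t \<omega>)) \<longlongrightarrow> exp (- N T \<omega>)) (at_left T)"
          by (intro tendsto_intros)
        then show "quenches_at D (z \<omega>) (real_of_ereal (\<tau> \<omega>))"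
          unfolding z_eq using elim(1) \<open>\<tau> \<omega> < \<infinity>\<close> T \<open>D \<noteq> {}\<close>
          by (intro quenches_at_scale) auto
      qed
    qed
    then show ?thesis using quench by (simp add: quenching_time_def)
  qed
  moreover have "AE \<omega> in M. \<tau> \<omega> \<le>
      tau_star \<eta>1 \<gamma> lam \<zeta>m \<mu>1 k a (inner_on D z0 \<psi>1) (\<lambda>t. N t \<omega>)"
    using sol pos contN
  proof eventually_elim
    case (elim \<omega>)
    have "\<forall>x\<in>D. \<zeta>m \<le> \<zeta> x" using zeta(3) closure_subset by blast
    with elim show ?case
      using \<open>\<zeta>m > 0\<close> const_pos
      by (intro tau_star_ge projected_solution_decay[OF eigen coeff_int _ _ _ _ _ g_lower]) auto
  qed
  then have "AE \<omega> in M.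
       tau_star \<eta>1 \<gamma> lam \<zeta>m \<mu>1 k a (inner_on D z0 \<psi>1) (\<lambda>t. N t \<omega>) < \<infinity> \<longrightarrow>
       \<tau> \<omega> < \<infinity> \<and>
       quenches_at D (v \<omega>) (real_of_ereal (\<tau> \<omega>)) \<and>
       quenches_at D (z \<omega>) (real_of_ereal (\<tau> \<omega>)) \<and>
       \<tau> \<omega> \<le> tau_star \<eta>1 \<gamma> lam \<zeta>m \<mu>1 k a (inner_on D z0 \<psi>1) (\<lambda>t. N t \<omega>)"
    using conjunct2[OF conjunct2[OF quench[unfolded quenching_time_def]]]
      conjunct2[OF conjunct2[OF qz[unfolded quenching_time_def]]]
  proof eventually_elim
    case (elim \<omega>)
    then show ?case by (meson order.strict_trans1)
  qed
  ultimately show ?thesis by blast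
qed

end
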